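(* Let $(\mathbb X,\mathbb T)$ be a tangent category with negatives and let $q\colon E\to M$ be a submersion in it. For each vertical connection $R$ on $q$ there exists exactly one horizontal connection $H_R$ on $q$ such that $(R,H_R)$ is an Ehresmann connection on $q$. Moreover, for each horizontal connection $H$ on $q$ there exists exactly one vertical connection $R_H$ on $q$ such that $(R_H,H)$ is an Ehresmann connection on $q$.
   Context: Composition is diagrammatic: $fg$ is $f$ followed by $g$; $\langle f,g\rangle$ denotes pairing into a (fibred) product, with projections $\pi_1,\pi_2$. A tangent category $(\mathbb X,\mathbb T)$ is a category $\mathbb X$ with an endofunctor $T$ and natural transformations $p_M\colon TM\to M$, $z_M\colon M\to TM$, $s_M\colon T_2M\to TM$, $l_M\colon TM\to T^2M$, $c_M\colon T^2M\to T^2M$, where the $n$-fold pullback $T_nM$ of $p_M$ along itself exists and is preserved by all $T^m$, such that: $(p_M,z_M,s_M)$ is an additive bundle (a commutative monoid in the category over $M$); $(z_M,l_M)\colon p_M\to Tp_M$ and $(\mathrm{id}_{TM},c_M)\colon Tp_M\to p_{TM}$ are additive bundle morphisms (commutative squares preserving zero and sum); $c_Mc_M=\mathrm{id}$, $l_Mc_M=l_M$, $l_M\,Tl_M=l_M\,l_{TM}$, $Tc_M\,c_{TM}\,Tc_M=c_{TM}\,Tc_M\,c_{TM}$, $l_{TM}\,Tc_M\,c_{TM}=c_M\,Tl_M$; and, with $\xi_M=\langle\pi_1l_M,\pi_2z_{TM}\rangle\,Ts_M\colon T_2M\to T^2M$, the square $\xi_M\,Tp_M=\pi_1p_Mz_M$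 is a tangent pullback. A tangent pullback is a pullback preserved by $T^m$ for all $m\ge0$. The tangent category has negatives if there is a natural transformation $n_M\colon TM\to TM$ over $M$ with $\langle n_M,\mathrm{id}_{TM}\rangle s_M=p_Mz_M$. A tangent display map is a morphism $q\colon E\to M$ such that for all $n\ge0$ and all $f\colon N\to T^nM$ the pullback of $T^nq$ along $f$ exists and is a tangent pullback. A differential bundle $\mathbf q\colon E\to M$ consists of $q\colon E\to M$, $z_q\colon M\to E$, $s_q\colon E_2\to E$, $l_q\colon E\to TE$ ($E_n$ the $n$-fold pullback of $q$ along itself, required to exist and be preserved by all $T^m$) such that $(q,z_q,s_q)$ is an additive bundle, $(z_M,l_q)\colon q\to Tq$ and $(z_q,l_q)\colon q\to p_E$ are additive bundle morphisms, $l_ql_E=l_q\,Tl_q$, and with $\xi_q=\langle\pi_1l_q,\pi_2z_E\rangle\,Ts_q\colon E_2\to TE$ the square $\xi_q\,Tq=\pi_1qz_M$ is a tangent pullback. Convention: all differential bundles are assumed display, i.e. $q$ is a tangent display map. A morphism $(f,g)\colon\mathbf q\to\mathbf q'$ (with $qf=gq'$) is linear if $g\,l_{q'}=l_q\,Tg$. $\mathsf{DB}(E)$ is the category of differential bundles over $E$ and linear morphisms over $\mathrm{id}_E$; it has finite biproducts, with zero object the trivial bundle $\mathbf 0_E=(\mathrm{id}_E,\mathrm{id}_E,\mathrm{id}_E,z_E)$. $\mathbf p_E=(p_E,z_E,s_E,l_E)$ is the tangent bundle. For a tangent display map $q\colon E\to M$: the vertical bundle $\mathbf q^V\colon Vq\to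 E$ is given by the tangent pullback $Vq$ of $Tq$ along $z_M$, with projections $\iota_q\colon Vq\to TE$ and $T^Vq\colon Vq\to M$; $q^V=\iota_qp_E$, and its zero $z_q^V$, sum $s^V_q$, lift $l_q^V$ are determined by $z_q^V\iota_q=z_E$, $s_q^V\iota_q=(\iota_q\times\iota_q)s_E$, $l_q^V\,T\iota_q=\iota_ql_E$. The Finsler bundle $\mathbf q^F\colon Fq\to E$ is given by the tangent pullback $Fq$ of $q$ along $p_M$, with projections $q^F\colon Fq\to E$ and $T^Fq\colon Fq\to TM$, its zero $z_q^F$, sum $s_q^F$, lift $l_q^F$ determined by $z_q^Fq^F=\mathrm{id}_E$, $z_q^F\,T^Fq=qz_M$; $s_q^Fq^F=\pi_1q^F$, $s_q^F\,T^Fq=(T^Fq\times T^Fq)s_M$; $l_q^F\,Tq^F=q^Fz_E$, $l_q^F\,T(T^Fq)=T^Fq\,l_M$. The horizontal descent $\pi_q\colon TE\to Fq$ is the unique morphism with $\pi_qq^F=p_E$ and $\pi_q\,T^Fq=Tq$. The square $\iota_q\pi_q=q^Vz_q^F$ (with corners $\mathbf q^V,\mathbf p_E,\mathbf 0_E,\mathbf q^F$) is commutative in $\mathsf{DB}(E)$; $q$ is a submersion if it is a pushout in $\mathsf{DB}(E)$. A vertical connection on $q$ is $R\colon TE\to Vq$ with $\iota_qR=\mathrm{id}_{Vq}$ and $R\colon\mathbf p_E\to\mathbf q^V$ linear over $E$ ($Rq^V=p_E$, $Rl_q^V=l_E\,TR$). A horizontal connection on $q$ is $H\colon Fq\to TE$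 with $H\pi_q=\mathrm{id}_{Fq}$ and $H\colon\mathbf q^F\to\mathbf p_E$ linear over $E$ ($Hp_E=q^F$, $Hl_E=l_q^F\,TH$). An Ehresmann connection on $q$ is a pair $(R,H)$ of a vertical and a horizontal connection with $HR=q^Fz_q^V$ and $\langle R\iota_q,\pi_qH\rangle s_E=\mathrm{id}_{TE}$. *)

theory Defs
  imports Main
begin

section \<open>Categories, pullbacks and pushouts\<close>

text \<open>Composition is diagrammatic: \<open>f \<cdot> g\<close> is \<open>f\<close> followed by \<open>g\<close>.\<close>

record ('o, 'm) category =
  Ob :: "'o set"
  Ar :: "'m set"
  Dom :: "'m \<Rightarrow> 'o"
  Cod :: "'m \<Rightarrow> 'o"
  Id :: "'o \<Rightarrow> 'm"
  Comp :: "'m \<Rightarrow> 'm \<Rightarrow> 'm" (infixl "\<cdot>\<index>" 70)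

definition hom :: "('o, 'm, 'x) category_scheme \<Rightarrow> 'o \<Rightarrow> 'o \<Rightarrow> 'm set" where
  "hom C A B = {f \<in> Ar C. Dom C f = A \<and> Cod C f = B}"

locale category =
  fixes C :: "('o, 'm, 'x) category_scheme" (structure)
  assumes dom_in_Ob: "f \<in> Ar C \<Longrightarrow> Dom C f \<in> Ob C"
    and cod_in_Ob: "f \<in> Ar C \<Longrightarrow> Cod C f \<in> Ob C"
    and id_in_hom: "A \<in> Ob C \<Longrightarrow> Id C A \<in> hom C A A"
    and comp_in_hom: "f \<in> hom C A B \<Longrightarrow> g \<in> hom C B D \<Longrightarrow> f \<cdot> g \<in> hom C A D"
    and id_comp: "f \<in> hom C A B \<Longrightarrow> Id C A \<cdot> f = f"
    and comp_id: "f \<in> hom C A B \<Longrightarrow> f \<cdot> Id C B = f"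
    and comp_assoc: "f \<in> hom C A B \<Longrightarrow> g \<in> hom C B D \<Longrightarrow> h \<in> hom C D F
      \<Longrightarrow> (f \<cdot> g) \<cdot> h = f \<cdot> (g \<cdot> h)"

text \<open>\<open>is_pullback C a b f g\<close>: the square \<open>a \<cdot> f = b \<cdot> g\<close> is a pullback;
  \<open>a\<close> and \<open>b\<close> are the projections.\<close>

definition is_pullback ::
  "('o, 'm, 'x) category_scheme \<Rightarrow> 'm \<Rightarrow> 'm \<Rightarrow> 'm \<Rightarrow> 'm \<Rightarrow> bool" where
  "is_pullback C a b f g \<longleftrightarrow>
     f \<in> Ar C \<and> g \<in> Ar C \<and> Cod C f = Cod C g
   \<and> a \<in> hom C (Dom C a) (Dom C f) \<and> b \<in> hom C (Dom C a) (Dom C g)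
   \<and> a \<cdot>\<^bsub>C\<^esub> f = b \<cdot>\<^bsub>C\<^esub> g
   \<and> (\<forall>Y x y. x \<in> hom C Y (Dom C f) \<and> y \<in> hom C Y (Dom C g) \<and> x \<cdot>\<^bsub>C\<^esub> f = y \<cdot>\<^bsub>C\<^esub> g \<longrightarrow>
        (\<exists>!h. h \<in> hom C Y (Dom C a) \<and> h \<cdot>\<^bsub>C\<^esub> a = x \<and> h \<cdot>\<^bsub>C\<^esub> b = y))"

text \<open>\<open>is_pushout C f g i j\<close>: the square \<open>f \<cdot> i = g \<cdot> j\<close> is a pushout of the span
  \<open>(f, g)\<close>, with injections \<open>i\<close> and \<open>j\<close>.\<close>

definition is_pushout ::
  "('o, 'm, 'x) category_scheme \<Rightarrow> 'm \<Rightarrow> 'm \<Rightarrow> 'm \<Rightarrow> 'm \<Rightarrow> bool" where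
  "is_pushout C f g i j \<longleftrightarrow>
     f \<in> Ar C \<and> g \<in> Ar C \<and> Dom C f = Dom C g
   \<and> i \<in> hom C (Cod C f) (Cod C i) \<and> j \<in> hom C (Cod C g) (Cod C i)
   \<and> f \<cdot>\<^bsub>C\<^esub> i = g \<cdot>\<^bsub>C\<^esub> j
   \<and> (\<forall>Y x y. x \<in> hom C (Cod C f) Y \<and> y \<in> hom C (Cod C g) Y \<and> f \<cdot>\<^bsub>C\<^esub> x = g \<cdot>\<^bsub>C\<^esub> y \<longrightarrow>
        (\<exists>!h. h \<in> hom C (Cod C i) Y \<and> i \<cdot>\<^bsub>C\<^esub> h = x \<and> j \<cdot>\<^bsub>C\<^esub> h = y))"

text \<open>The pairing \<open>\<langle>f, g\<rangle>\<close> into a pullback with projections \<open>a\<close> and \<open>b\<close>.\<close>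

definition pairing ::
  "('o, 'm, 'x) category_scheme \<Rightarrow> 'm \<Rightarrow> 'm \<Rightarrow> 'm \<Rightarrow> 'm \<Rightarrow> 'm" where
  "pairing C a b f g =
     (THE h. h \<in> hom C (Dom C f) (Dom C a) \<and> h \<cdot>\<^bsub>C\<^esub> a = f \<and> h \<cdot>\<^bsub>C\<^esub> b = g)"

text \<open>\<open>is_fibre_power C q n r b\<close>: the object \<open>Dom C b\<close> is an \<open>n\<close>-fold pullback of \<open>q\<close> along
  itself, with projections \<open>r 0, \<dots>, r (n - 1)\<close> and structure map \<open>b\<close> to the base of \<open>q\<close>.
  For \<open>n = 0\<close> this says that \<open>b\<close> is an isomorphism.\<close>

definition is_fibre_power ::
  "('o, 'm, 'x) category_scheme \<Rightarrow> 'm \<Rightarrow> nat \<Rightarrow> (nat \<Rightarrow> 'm) \<Rightarrow> 'm \<Rightarrow> bool" where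
  "is_fibre_power C q n r b \<longleftrightarrow>
     q \<in> Ar C \<and> b \<in> hom C (Dom C b) (Cod C q)
   \<and> (\<forall>i<n. r i \<in> hom C (Dom C b) (Dom C q) \<and> r i \<cdot>\<^bsub>C\<^esub> q = b)
   \<and> (\<forall>Y c y. c \<in> hom C Y (Cod C q)
        \<and> (\<forall>i<n. y i \<in> hom C Y (Dom C q) \<and> y i \<cdot>\<^bsub>C\<^esub> q = c) \<longrightarrow>
        (\<exists>!h. h \<in> hom C Y (Dom C b) \<and> h \<cdot>\<^bsub>C\<^esub> b = c \<and> (\<forall>i<n. h \<cdot>\<^bsub>C\<^esub> r i = y i)))"


section \<open>Additive bundles\<close>

text \<open>The sum of a bundle \<open>q : E \<rightarrow> M\<close> is an arrow out of the fibre product \<open>E\<^sub>2\<close>, so a bundle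
  carries a choice of \<open>E\<^sub>2\<close>, given by its two projections to \<open>E\<close>.\<close>

record 'm bundle_data =
  proj :: 'm
  zero :: 'm
  add :: 'm
  pr1 :: 'm
  pr2 :: 'm

record 'm lifted_bundle = "'m bundle_data" +
  lift :: 'm

definition total_ob ::
  "('o, 'm, 'x) category_scheme \<Rightarrow> ('m, 'b) bundle_data_scheme \<Rightarrow> 'o" where
  "total_ob C B = Dom C (proj B)"

definition base_ob ::
  "('o, 'm, 'x) category_scheme \<Rightarrow> ('m, 'b) bundle_data_scheme \<Rightarrow> 'o" where
  "base_ob C B = Cod C (proj B)"

definition pair2 ::
  "('o, 'm, 'x) category_scheme \<Rightarrow> ('m, 'b) bundle_data_scheme \<Rightarrow> 'm \<Rightarrow> 'm \<Rightarrow> 'm" where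
  "pair2 C B f g = pairing C (pr1 B) (pr2 B) f g"

definition additive_bundle ::
  "('o, 'm, 'x) category_scheme \<Rightarrow> ('m, 'b) bundle_data_scheme \<Rightarrow> bool" where
  "additive_bundle C B \<longleftrightarrow>
     is_pullback C (pr1 B) (pr2 B) (proj B) (proj B)
   \<and> zero B \<in> hom C (base_ob C B) (total_ob C B)
   \<and> add B \<in> hom C (Dom C (pr1 B)) (total_ob C B)
   \<and> zero B \<cdot>\<^bsub>C\<^esub> proj B = Id C (base_ob C B)
   \<and> add B \<cdot>\<^bsub>C\<^esub> proj B = pr1 B \<cdot>\<^bsub>C\<^esub> proj B
   \<and> pair2 C B (proj B \<cdot>\<^bsub>C\<^esub> zero B) (Id C (total_ob C B)) \<cdot>\<^bsub>C\<^esub> add B = Id C (total_ob C B)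
   \<and> pair2 C B (pr2 B) (pr1 B) \<cdot>\<^bsub>C\<^esub> add B = add B
   \<and> (\<forall>r b. is_fibre_power C (proj B) 3 r b \<longrightarrow>
        pair2 C B (pair2 C B (r 0) (r 1) \<cdot>\<^bsub>C\<^esub> add B) (r 2) \<cdot>\<^bsub>C\<^esub> add B =
        pair2 C B (r 0) (pair2 C B (r 1) (r 2) \<cdot>\<^bsub>C\<^esub> add B) \<cdot>\<^bsub>C\<^esub> add B)"

definition additive_bundle_morphism ::
  "('o, 'm, 'x) category_scheme \<Rightarrow> ('m, 'b) bundle_data_scheme \<Rightarrow> ('m, 'c) bundle_data_scheme
    \<Rightarrow> 'm \<Rightarrow> 'm \<Rightarrow> bool" where
  "additive_bundle_morphism C B B' f g \<longleftrightarrow>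
     f \<in> hom C (base_ob C B) (base_ob C B')
   \<and> g \<in> hom C (total_ob C B) (total_ob C B')
   \<and> proj B \<cdot>\<^bsub>C\<^esub> f = g \<cdot>\<^bsub>C\<^esub> proj B'
   \<and> zero B \<cdot>\<^bsub>C\<^esub> g = f \<cdot>\<^bsub>C\<^esub> zero B'
   \<and> add B \<cdot>\<^bsub>C\<^esub> g = pair2 C B' (pr1 B \<cdot>\<^bsub>C\<^esub> g) (pr2 B \<cdot>\<^bsub>C\<^esub> g) \<cdot>\<^bsub>C\<^esub> add B'"


section \<open>Tangent categories\<close>

text \<open>\<open>T_pr1 X M\<close> and \<open>T_pr2 X M\<close> are the projections of the chosen fibre product \<open>T\<^sub>2 M\<close>.\<close>

record ('o, 'm) tangent_category = "('o, 'm) category" +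
  T_ob :: "'o \<Rightarrow> 'o"
  T_ar :: "'m \<Rightarrow> 'm"
  T_proj :: "'o \<Rightarrow> 'm"
  T_zero :: "'o \<Rightarrow> 'm"
  T_sum :: "'o \<Rightarrow> 'm"
  T_pr1 :: "'o \<Rightarrow> 'm"
  T_pr2 :: "'o \<Rightarrow> 'm"
  T_lift :: "'o \<Rightarrow> 'm"
  T_flip :: "'o \<Rightarrow> 'm"

definition tangent_bundle ::
  "('o, 'm, 'x) tangent_category_scheme \<Rightarrow> 'o \<Rightarrow> 'm lifted_bundle" where
  "tangent_bundle X M =
     \<lparr>proj = T_proj X M, zero = T_zero X M, add = T_sum X M,
      pr1 = T_pr1 X M, pr2 = T_pr2 X M, lift = T_lift X M\<rparr>"

definition T_bundle ::
  "('o, 'm, 'x) tangent_category_scheme \<Rightarrow> ('m, 'b) bundle_data_scheme \<Rightarrow> 'm bundle_data" where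
  "T_bundle X B =
     \<lparr>proj = T_ar X (proj B), zero = T_ar X (zero B), add = T_ar X (add B),
      pr1 = T_ar X (pr1 B), pr2 = T_ar X (pr2 B)\<rparr>"

definition tangent_pullback ::
  "('o, 'm, 'x) tangent_category_scheme \<Rightarrow> 'm \<Rightarrow> 'm \<Rightarrow> 'm \<Rightarrow> 'm \<Rightarrow> bool" where
  "tangent_pullback X a b f g \<longleftrightarrow>
     (\<forall>m. is_pullback X ((T_ar X ^^ m) a) ((T_ar X ^^ m) b) ((T_ar X ^^ m) f) ((T_ar X ^^ m) g))"

definition has_tangent_fibre_powers ::
  "('o, 'm, 'x) tangent_category_scheme \<Rightarrow> 'm \<Rightarrow> bool" where
  "has_tangent_fibre_powers X q \<longleftrightarrow>
     (\<forall>n. \<exists>r b. \<forall>m. is_fibre_power X ((T_ar X ^^ m) q) n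
        (\<lambda>i. (T_ar X ^^ m) (r i)) ((T_ar X ^^ m) b))"

text \<open>The arrow \<open>\<xi> = \<langle>\<pi>\<^sub>1 l, \<pi>\<^sub>2 z\<^sub>E\<rangle> T s : E\<^sub>2 \<rightarrow> T E\<close>, where \<open>E\<close> is the total object. For the
  tangent bundle of \<open>M\<close> it is \<open>\<xi>\<^sub>M = \<langle>\<pi>\<^sub>1 l\<^sub>M, \<pi>\<^sub>2 z\<^bsub>TM\<^esub>\<rangle> T s\<^sub>M\<close>.\<close>

definition xi ::
  "('o, 'm, 'x) tangent_category_scheme \<Rightarrow> 'm lifted_bundle \<Rightarrow> 'm" where
  "xi X B =
     pair2 X (T_bundle X B) (pr1 B \<cdot>\<^bsub>X\<^esub> lift B) (pr2 B \<cdot>\<^bsub>X\<^esub> T_zero X (total_ob X B))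
       \<cdot>\<^bsub>X\<^esub> T_ar X (add B)"

locale tangent_category = category X
  for X :: "('o, 'm, 'x) tangent_category_scheme" (structure) +
  assumes T_ob: "M \<in> Ob X \<Longrightarrow> T_ob X M \<in> Ob X"
    and T_ar: "f \<in> hom X M N \<Longrightarrow> T_ar X f \<in> hom X (T_ob X M) (T_ob X N)"
    and T_id: "M \<in> Ob X \<Longrightarrow> T_ar X (Id X M) = Id X (T_ob X M)"
    and T_comp: "f \<in> hom X M N \<Longrightarrow> g \<in> hom X N K \<Longrightarrow> T_ar X (f \<cdot> g) = T_ar X f \<cdot> T_ar X g"
    and proj_in_hom: "M \<in> Ob X \<Longrightarrow> T_proj X M \<in> hom X (T_ob X M) M"
    and lift_in_hom: "M \<in> Ob X \<Longrightarrow> T_lift X M \<in> hom X (T_ob X M) (T_ob X (T_ob X M))"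
    and flip_in_hom:
      "M \<in> Ob X \<Longrightarrow> T_flip X M \<in> hom X (T_ob X (T_ob X M)) (T_ob X (T_ob X M))"
    and fibre_powers: "M \<in> Ob X \<Longrightarrow> has_tangent_fibre_powers X (T_proj X M)"
    and T2_pullback:
      "M \<in> Ob X \<Longrightarrow> tangent_pullback X (T_pr1 X M) (T_pr2 X M) (T_proj X M) (T_proj X M)"
    and additive: "M \<in> Ob X \<Longrightarrow> additive_bundle X (tangent_bundle X M)"
    and proj_natural: "f \<in> hom X M N \<Longrightarrow> T_ar X f \<cdot> T_proj X N = T_proj X M \<cdot> f"
    and zero_natural: "f \<in> hom X M N \<Longrightarrow> f \<cdot> T_zero X N = T_zero X M \<cdot> T_ar X f"
    and sum_natural: "f \<in> hom X M N \<Longrightarrow>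
      pair2 X (tangent_bundle X N) (T_pr1 X M \<cdot> T_ar X f) (T_pr2 X M \<cdot> T_ar X f) \<cdot> T_sum X N
        = T_sum X M \<cdot> T_ar X f"
    and lift_natural:
      "f \<in> hom X M N \<Longrightarrow> T_ar X f \<cdot> T_lift X N = T_lift X M \<cdot> T_ar X (T_ar X f)"
    and flip_natural:
      "f \<in> hom X M N \<Longrightarrow> T_ar X (T_ar X f) \<cdot> T_flip X N = T_flip X M \<cdot> T_ar X (T_ar X f)"
    and lift_additive: "M \<in> Ob X \<Longrightarrow>
      additive_bundle_morphism X (tangent_bundle X M) (T_bundle X (tangent_bundle X M))
        (T_zero X M) (T_lift X M)"
    and flip_additive: "M \<in> Ob X \<Longrightarrow>
      additive_bundle_morphism X (T_bundle X (tangent_bundle X M)) (tangent_bundle X (T_ob X M))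
        (Id X (T_ob X M)) (T_flip X M)"
    and flip_flip: "M \<in> Ob X \<Longrightarrow> T_flip X M \<cdot> T_flip X M = Id X (T_ob X (T_ob X M))"
    and lift_flip: "M \<in> Ob X \<Longrightarrow> T_lift X M \<cdot> T_flip X M = T_lift X M"
    and lift_lift:
      "M \<in> Ob X \<Longrightarrow> T_lift X M \<cdot> T_ar X (T_lift X M) = T_lift X M \<cdot> T_lift X (T_ob X M)"
    and flip_braid: "M \<in> Ob X \<Longrightarrow>
      T_ar X (T_flip X M) \<cdot> T_flip X (T_ob X M) \<cdot> T_ar X (T_flip X M)
        = T_flip X (T_ob X M) \<cdot> T_ar X (T_flip X M) \<cdot> T_flip X (T_ob X M)"
    and lift_flip_flip: "M \<in> Ob X \<Longrightarrow>
      T_lift X (T_ob X M) \<cdot> T_ar X (T_flip X M) \<cdot> T_flip X (T_ob X M)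
        = T_flip X M \<cdot> T_ar X (T_lift X M)"
    and universal_lift: "M \<in> Ob X \<Longrightarrow>
      tangent_pullback X (xi X (tangent_bundle X M)) (T_pr1 X M \<cdot> T_proj X M)
        (T_ar X (T_proj X M)) (T_zero X M)"

definition has_negatives :: "('o, 'm, 'x) tangent_category_scheme \<Rightarrow> bool" where
  "has_negatives X \<longleftrightarrow>
     (\<exists>n. (\<forall>M \<in> Ob X.
             n M \<in> hom X (T_ob X M) (T_ob X M)
           \<and> n M \<cdot>\<^bsub>X\<^esub> T_proj X M = T_proj X M
           \<and> pair2 X (tangent_bundle X M) (n M) (Id X (T_ob X M)) \<cdot>\<^bsub>X\<^esub> T_sum X M
               = T_proj X M \<cdot>\<^bsub>X\<^esub> T_zero X M)
        \<and> (\<forall>M N f. f \<in> hom X M N \<longrightarrow> T_ar X f \<cdot>\<^bsub>X\<^esub> n N = n M \<cdot>\<^bsub>X\<^esub> T_ar X f))"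

definition tangent_display_map ::
  "('o, 'm, 'x) tangent_category_scheme \<Rightarrow> 'm \<Rightarrow> bool" where
  "tangent_display_map X q \<longleftrightarrow>
     q \<in> Ar X
   \<and> (\<forall>n N f. f \<in> hom X N ((T_ob X ^^ n) (Cod X q)) \<longrightarrow>
        (\<exists>a b. tangent_pullback X a b ((T_ar X ^^ n) q) f))"


section \<open>Differential bundles\<close>

text \<open>All differential bundles are assumed to be display.\<close>

definition differential_bundle ::
  "('o, 'm, 'x) tangent_category_scheme \<Rightarrow> 'm lifted_bundle \<Rightarrow> bool" where
  "differential_bundle X B \<longleftrightarrow>
     tangent_display_map X (proj B)
   \<and> has_tangent_fibre_powers X (proj B)
   \<and> tangent_pullback X (pr1 B) (pr2 B) (proj B) (proj B)
   \<and> additive_bundle X B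
   \<and> lift B \<in> hom X (total_ob X B) (T_ob X (total_ob X B))
   \<and> additive_bundle_morphism X B (T_bundle X B) (T_zero X (base_ob X B)) (lift B)
   \<and> additive_bundle_morphism X B (tangent_bundle X (total_ob X B)) (zero B) (lift B)
   \<and> lift B \<cdot>\<^bsub>X\<^esub> T_lift X (total_ob X B) = lift B \<cdot>\<^bsub>X\<^esub> T_ar X (lift B)
   \<and> tangent_pullback X (xi X B) (pr1 B \<cdot>\<^bsub>X\<^esub> proj B) (T_ar X (proj B)) (T_zero X (base_ob X B))"

definition linear_morphism ::
  "('o, 'm, 'x) tangent_category_scheme \<Rightarrow> 'm lifted_bundle \<Rightarrow> 'm lifted_bundle
    \<Rightarrow> 'm \<Rightarrow> 'm \<Rightarrow> bool" where
  "linear_morphism X B B' f g \<longleftrightarrow>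
     f \<in> hom X (base_ob X B) (base_ob X B')
   \<and> g \<in> hom X (total_ob X B) (total_ob X B')
   \<and> proj B \<cdot>\<^bsub>X\<^esub> f = g \<cdot>\<^bsub>X\<^esub> proj B'
   \<and> g \<cdot>\<^bsub>X\<^esub> lift B' = lift B \<cdot>\<^bsub>X\<^esub> T_ar X g"

text \<open>The category of differential bundles over \<open>E\<close>. The same arrow can be linear between
  different bundles, so an arrow of \<open>DB X E\<close> records its domain and codomain.\<close>

definition DB :: "('o, 'm, 'x) tangent_category_scheme \<Rightarrow> 'o
    \<Rightarrow> ('m lifted_bundle, 'm lifted_bundle \<times> 'm \<times> 'm lifted_bundle) category" where
  "DB X E =
     \<lparr>Ob = {B. differential_bundle X B \<and> base_ob X B = E},
      Ar = {(B, g, B'). differential_bundle X B \<and> base_ob X B = E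
              \<and> differential_bundle X B' \<and> base_ob X B' = E
              \<and> linear_morphism X B B' (Id X E) g},
      Dom = (\<lambda>(B, g, B'). B),
      Cod = (\<lambda>(B, g, B'). B'),
      Id = (\<lambda>B. (B, Id X (total_ob X B), B)),
      Comp = (\<lambda>(B, g, _) (_, h, B'). (B, g \<cdot>\<^bsub>X\<^esub> h, B'))\<rparr>"

definition trivial_bundle ::
  "('o, 'm, 'x) tangent_category_scheme \<Rightarrow> 'o \<Rightarrow> 'm lifted_bundle" where
  "trivial_bundle X E =
     \<lparr>proj = Id X E, zero = Id X E, add = Id X E, pr1 = Id X E, pr2 = Id X E,
      lift = T_zero X E\<rparr>"


section \<open>Vertical and Finsler bundles, submersions\<close>

text \<open>Pullbacks are not chosen globally. \<open>vertical_bundle X q V \<iota> t\<close> says that \<open>V\<close> is a vertical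
  bundle of \<open>q\<close>, built on a pullback of \<open>T q\<close> along \<open>z\<^sub>M\<close> with projections \<open>\<iota>\<close> to \<open>T E\<close> and
  \<open>t\<close> to \<open>M\<close>. The equations determine \<open>V\<close> up to the choices of \<open>V q\<close> and \<open>(V q)\<^sub>2\<close>.\<close>

definition vertical_bundle ::
  "('o, 'm, 'x) tangent_category_scheme \<Rightarrow> 'm \<Rightarrow> 'm lifted_bundle \<Rightarrow> 'm \<Rightarrow> 'm \<Rightarrow> bool" where
  "vertical_bundle X q V \<iota> t \<longleftrightarrow>
     (let E = Dom X q; M = Cod X q; Vq = Dom X \<iota> in
       tangent_pullback X \<iota> t (T_ar X q) (T_zero X M)
     \<and> proj V = \<iota> \<cdot>\<^bsub>X\<^esub> T_proj X E
     \<and> tangent_pullback X (pr1 V) (pr2 V) (proj V) (proj V)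
     \<and> zero V \<in> hom X E Vq
     \<and> zero V \<cdot>\<^bsub>X\<^esub> \<iota> = T_zero X E
     \<and> add V \<in> hom X (Dom X (pr1 V)) Vq
     \<and> add V \<cdot>\<^bsub>X\<^esub> \<iota> =
         pair2 X (tangent_bundle X E) (pr1 V \<cdot>\<^bsub>X\<^esub> \<iota>) (pr2 V \<cdot>\<^bsub>X\<^esub> \<iota>) \<cdot>\<^bsub>X\<^esub> T_sum X E
     \<and> lift V \<in> hom X Vq (T_ob X Vq)
     \<and> lift V \<cdot>\<^bsub>X\<^esub> T_ar X \<iota> = \<iota> \<cdot>\<^bsub>X\<^esub> T_lift X E)"

text \<open>\<open>finsler_bundle X q F t\<close>: here \<open>F q\<close> is a pullback of \<open>q\<close> along \<open>p\<^sub>M\<close>, with projections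
  \<open>proj F\<close> to \<open>E\<close> and \<open>t\<close> to \<open>T M\<close>.\<close>

definition finsler_bundle ::
  "('o, 'm, 'x) tangent_category_scheme \<Rightarrow> 'm \<Rightarrow> 'm lifted_bundle \<Rightarrow> 'm \<Rightarrow> bool" where
  "finsler_bundle X q F t \<longleftrightarrow>
     (let E = Dom X q; M = Cod X q; Fq = total_ob X F in
       tangent_pullback X (proj F) t q (T_proj X M)
     \<and> tangent_pullback X (pr1 F) (pr2 F) (proj F) (proj F)
     \<and> zero F \<in> hom X E Fq
     \<and> zero F \<cdot>\<^bsub>X\<^esub> proj F = Id X E
     \<and> zero F \<cdot>\<^bsub>X\<^esub> t = q \<cdot>\<^bsub>X\<^esub> T_zero X M
     \<and> add F \<in> hom X (Dom X (pr1 F)) Fq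
     \<and> add F \<cdot>\<^bsub>X\<^esub> proj F = pr1 F \<cdot>\<^bsub>X\<^esub> proj F
     \<and> add F \<cdot>\<^bsub>X\<^esub> t =
         pair2 X (tangent_bundle X M) (pr1 F \<cdot>\<^bsub>X\<^esub> t) (pr2 F \<cdot>\<^bsub>X\<^esub> t) \<cdot>\<^bsub>X\<^esub> T_sum X M
     \<and> lift F \<in> hom X Fq (T_ob X Fq)
     \<and> lift F \<cdot>\<^bsub>X\<^esub> T_ar X (proj F) = proj F \<cdot>\<^bsub>X\<^esub> T_zero X E
     \<and> lift F \<cdot>\<^bsub>X\<^esub> T_ar X t = t \<cdot>\<^bsub>X\<^esub> T_lift X M)"

definition horizontal_descent ::
  "('o, 'm, 'x) tangent_category_scheme \<Rightarrow> 'm \<Rightarrow> 'm lifted_bundle \<Rightarrow> 'm \<Rightarrow> 'm" where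
  "horizontal_descent X q F t = pairing X (proj F) t (T_proj X (Dom X q)) (T_ar X q)"

text \<open>\<open>V\<close>, \<open>\<iota>\<close>, \<open>tV\<close> and \<open>F\<close>, \<open>tF\<close> are the chosen vertical and Finsler bundles of \<open>q\<close>. The
  square is \<open>\<iota> \<pi> = q\<^sup>V z\<^sup>F\<close>; being a pushout in \<open>DB X E\<close> includes that its corners and
  sides lie in that category.\<close>

definition submersion ::
  "('o, 'm, 'x) tangent_category_scheme \<Rightarrow> 'm \<Rightarrow> 'm lifted_bundle \<Rightarrow> 'm \<Rightarrow> 'm
    \<Rightarrow> 'm lifted_bundle \<Rightarrow> 'm \<Rightarrow> bool" where
  "submersion X q V \<iota> tV F tF \<longleftrightarrow>
     tangent_display_map X q
   \<and> vertical_bundle X q V \<iota> tV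
   \<and> finsler_bundle X q F tF
   \<and> (let E = Dom X q; P = tangent_bundle X E; Z = trivial_bundle X E in
        is_pushout (DB X E)
          (V, \<iota>, P)
          (V, proj V, Z)
          (P, horizontal_descent X q F tF, F)
          (Z, zero F, F))"


section \<open>Connections\<close>

definition vertical_connection ::
  "('o, 'm, 'x) tangent_category_scheme \<Rightarrow> 'm \<Rightarrow> 'm lifted_bundle \<Rightarrow> 'm \<Rightarrow> 'm \<Rightarrow> bool" where
  "vertical_connection X q V \<iota> R \<longleftrightarrow>
     \<iota> \<cdot>\<^bsub>X\<^esub> R = Id X (total_ob X V)
   \<and> linear_morphism X (tangent_bundle X (Dom X q)) V (Id X (Dom X q)) R"

definition horizontal_connection ::
  "('o, 'm, 'x) tangent_category_scheme \<Rightarrow> 'm \<Rightarrow> 'm lifted_bundle \<Rightarrow> 'm \<Rightarrow> 'm \<Rightarrow> bool" where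
  "horizontal_connection X q F tF H \<longleftrightarrow>
     H \<cdot>\<^bsub>X\<^esub> horizontal_descent X q F tF = Id X (total_ob X F)
   \<and> linear_morphism X F (tangent_bundle X (Dom X q)) (Id X (Dom X q)) H"

definition ehresmann_connection ::
  "('o, 'm, 'x) tangent_category_scheme \<Rightarrow> 'm \<Rightarrow> 'm lifted_bundle \<Rightarrow> 'm
    \<Rightarrow> 'm lifted_bundle \<Rightarrow> 'm \<Rightarrow> 'm \<Rightarrow> 'm \<Rightarrow> bool" where
  "ehresmann_connection X q V \<iota> F tF R H \<longleftrightarrow>
     vertical_connection X q V \<iota> R
   \<and> horizontal_connection X q F tF H
   \<and> H \<cdot>\<^bsub>X\<^esub> R = proj F \<cdot>\<^bsub>X\<^esub> zero V
   \<and> pair2 X (tangent_bundle X (Dom X q)) (R \<cdot>\<^bsub>X\<^esub> \<iota>) (horizontal_descent X q F tF \<cdot>\<^bsub>X\<^esub> H)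
        \<cdot>\<^bsub>X\<^esub> T_sum X (Dom X q) = Id X (T_ob X (Dom X q))"

end

theory Submission
  imports Defs
begin

text \<open>Write \<open>+\<close> for the sum of arrows into \<open>T E\<close> that lie over the same arrow into \<open>E\<close>. Negatives
  turn such arrows into abelian groups, and an Ehresmann connection is a splitting
  \<open>R \<iota> + \<pi> H = id\<close> of \<open>T E\<close> into a vertical and a horizontal part. Hence each of \<open>R\<close> and \<open>H\<close>
  determines the other: given one of them, the other one has to be extracted from a difference.

  Given \<open>R\<close>, put \<open>\<phi> = id - R \<iota>\<close>. It is a linear endomorphism of the tangent bundle with
  \<open>\<iota> \<phi> = 0\<close>, since \<open>\<iota> R = id\<close>. As \<open>q\<close> is a submersion, \<open>\<pi>\<close> is a cokernel of \<open>\<iota>\<close> among linear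
  morphisms, so \<open>\<phi> = \<pi> H\<close> for a unique linear \<open>H\<close>. Since \<open>R \<iota>\<close> is vertical, \<open>\<phi>\<close> has the same image
  under \<open>\<pi>\<close> as the identity, that is \<open>\<pi> H \<pi> = \<pi>\<close>, and cancelling \<open>\<pi>\<close> gives \<open>H \<pi> = id\<close>.

  Given \<open>H\<close>, put \<open>\<psi> = id - \<pi> H\<close>. It is linear and \<open>\<psi> T(q) = 0\<close>, because \<open>\<pi> H T(q) = T(q)\<close>. As
  \<open>V q\<close> is the kernel of \<open>T(q)\<close>, there is a unique \<open>R\<close> with \<open>R \<iota> = \<psi>\<close>; it is linear because \<open>T(\<iota>)\<close>
  is mono, and \<open>\<iota> R = id\<close> because \<open>\<iota>\<close> is mono and \<open>\<iota> \<psi> = \<iota> - \<iota> \<pi> H = \<iota>\<close>.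

  Two points carry the argument. One is that such differences are linear
  (\<open>complement_linear\<close>). The other is that the equation \<open>H R = 0\<close> is a consequence of
  \<open>R \<iota> + \<pi> H = id\<close> (\<open>ehresmann_connection_iff\<close>), so that only this decomposition has to be
  considered. Both rest on cancellation in the tangent bundle (\<open>tsum_right_cancel\<close>). That
  \<open>\<iota> \<pi> H\<close> is zero uses that linear morphisms preserve zeros (\<open>linear_preserves_zero\<close>).\<close>

section \<open>Arrows, pullbacks and pairings\<close>

context category
begin

lemma comp_arr [simp]:
  assumes "f \<in> Ar C" "g \<in> Ar C" "Cod C f = Dom C g"
  shows "f \<cdot> g \<in> Ar C" "Dom C (f \<cdot> g) = Dom C f" "Cod C (f \<cdot> g) = Cod C g"
  using comp_in_hom[of f "Dom C f" "Cod C f" g "Cod C g"] assms by (auto simp: hom_def)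

lemma id_arr [simp]:
  assumes "A \<in> Ob C"
  shows "Id C A \<in> Ar C" "Dom C (Id C A) = A" "Cod C (Id C A) = A"
  using id_in_hom[OF assms] by (auto simp: hom_def)

lemma comp_assoc' [simp]:
  assumes "f \<in> Ar C" "g \<in> Ar C" "h \<in> Ar C" "Cod C f = Dom C g" "Cod C g = Dom C h"
  shows "(f \<cdot> g) \<cdot> h = f \<cdot> (g \<cdot> h)"
  using comp_assoc[of f "Dom C f" "Cod C f" g "Cod C g" h "Cod C h"] assms
  by (auto simp: hom_def)

lemma id_comp' [simp]: "f \<in> Ar C \<Longrightarrow> Dom C f = A \<Longrightarrow> Id C A \<cdot> f = f"
  using id_comp[of f A "Cod C f"] by (auto simp: hom_def)

lemma comp_id' [simp]: "f \<in> Ar C \<Longrightarrow> Cod C f = A \<Longrightarrow> f \<cdot> Id C A = f"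
  using comp_id[of f "Dom C f" A] by (auto simp: hom_def)

lemma comp_cong_left:
  assumes "f \<cdot> g = k" "f \<in> Ar C" "g \<in> Ar C" "h \<in> Ar C" "Cod C f = Dom C g" "Cod C g = Dom C h"
  shows "f \<cdot> (g \<cdot> h) = k \<cdot> h"
  using comp_assoc'[OF assms(2-6)] assms(1) by simp

lemma pullbackD:
  assumes "is_pullback C a b f g"
  shows "f \<in> Ar C" "g \<in> Ar C" "a \<in> Ar C" "b \<in> Ar C" "Cod C g = Cod C f" "Dom C b = Dom C a"
    "Cod C a = Dom C f" "Cod C b = Dom C g" "a \<cdot> f = b \<cdot> g"
  using assms by (auto simp: is_pullback_def hom_def)

lemma pullback_ext:
  assumes "is_pullback C a b f g"
    and "h \<in> Ar C" "k \<in> Ar C" "Dom C h = Dom C k" "Cod C h = Dom C a" "Cod C k = Dom C a"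
    and "h \<cdot> a = k \<cdot> a" "h \<cdot> b = k \<cdot> b"
  shows "h = k"
proof -
  note d = pullbackD[OF assms(1)]
  have "k \<cdot> a \<in> hom C (Dom C k) (Dom C f)" "k \<cdot> b \<in> hom C (Dom C k) (Dom C g)"
    "(k \<cdot> a) \<cdot> f = (k \<cdot> b) \<cdot> g"
    using assms d by (auto simp: hom_def)
  then have "\<exists>!h. h \<in> hom C (Dom C k) (Dom C a) \<and> h \<cdot> a = k \<cdot> a \<and> h \<cdot> b = k \<cdot> b"
    using assms(1) by (simp add: is_pullback_def)
  moreover have "h \<in> hom C (Dom C k) (Dom C a)" "k \<in> hom C (Dom C k) (Dom C a)"
    using assms by (auto simp: hom_def)
  ultimately show ?thesis using assms(7,8) by blast
qed

lemma pairing: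
  assumes "is_pullback C a b f g"
    and "x \<in> Ar C" "y \<in> Ar C" "Dom C x = Dom C y" "Cod C x = Dom C f" "Cod C y = Dom C g"
    and "x \<cdot> f = y \<cdot> g"
  shows "pairing C a b x y \<in> Ar C" "Dom C (pairing C a b x y) = Dom C x"
    "Cod C (pairing C a b x y) = Dom C a"
    "pairing C a b x y \<cdot> a = x" "pairing C a b x y \<cdot> b = y"
proof -
  have "\<exists>!h. h \<in> hom C (Dom C x) (Dom C a) \<and> h \<cdot> a = x \<and> h \<cdot> b = y"
  proof -
    have "x \<in> hom C (Dom C x) (Dom C f)" "y \<in> hom C (Dom C x) (Dom C g)"
      using assms by (auto simp: hom_def)
    then show ?thesis
      using assms(1,7) by (simp add: is_pullback_def)
  qed
  from theI'[OF this] show "pairing C a b x y \<in> Ar C" "Dom C (pairing C a b x y) = Dom C x"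
    "Cod C (pairing C a b x y) = Dom C a"
    "pairing C a b x y \<cdot> a = x" "pairing C a b x y \<cdot> b = y"
    by (auto simp: pairing_def hom_def)
qed

lemma pairing_unique:
  assumes "is_pullback C a b f g"
    and "h \<in> Ar C" "Cod C h = Dom C a"
    and "h \<cdot> a = x" "h \<cdot> b = y"
  shows "pairing C a b x y = h"
proof -
  note d = pullbackD[OF assms(1)]
  have xy: "x \<in> Ar C" "y \<in> Ar C" "Dom C x = Dom C h" "Dom C y = Dom C h"
    "Cod C x = Dom C f" "Cod C y = Dom C g" "x \<cdot> f = y \<cdot> g"
    using assms d by auto
  show ?thesis
    by (rule pullback_ext[OF assms(1)]) (use xy pairing[OF assms(1)] assms in auto)
qed

lemma comp_pairing:
  assumes "is_pullback C a b f g"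
    and "x \<in> Ar C" "y \<in> Ar C" "Dom C x = Dom C y" "Cod C x = Dom C f" "Cod C y = Dom C g"
    and "x \<cdot> f = y \<cdot> g" and "k \<in> Ar C" "Cod C k = Dom C x"
  shows "k \<cdot> pairing C a b x y = pairing C a b (k \<cdot> x) (k \<cdot> y)"
  using pairing[OF assms(1-7)] assms(8,9) pullbackD[OF assms(1)]
  by (intro pairing_unique[OF assms(1), symmetric]) auto

text \<open>The zero section \<open>z\<^sub>M\<close> is split by \<open>p\<^sub>M\<close>, and so is \<open>T(z\<^sub>M)\<close> by \<open>T(p\<^sub>M)\<close>. This makes the
  inclusion of the vertical bundle, and its image under \<open>T\<close>, mono.\<close>

lemma pullback_of_split_mono_is_mono:
  assumes pb: "is_pullback C a b f g"
    and r: "r \<in> Ar C" "Dom C r = Cod C g" "g \<cdot> r = Id C (Dom C g)"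
    and hk: "h \<in> Ar C" "k \<in> Ar C" "Dom C h = Dom C k" "Cod C h = Dom C a" "Cod C k = Dom C a"
    and eq: "h \<cdot> a = k \<cdot> a"
  shows "h = k"
proof (rule pullback_ext[OF pb hk eq])
  note d = pullbackD[OF pb]
  have *: "x \<cdot> b = (x \<cdot> a) \<cdot> (f \<cdot> r)" if "x \<in> Ar C" "Cod C x = Dom C a" for x
  proof -
    have "x \<cdot> b = x \<cdot> (b \<cdot> (g \<cdot> r))"
      using d r by simp
    also have "\<dots> = x \<cdot> ((b \<cdot> g) \<cdot> r)"
      using d r by simp
    also have "\<dots> = x \<cdot> ((a \<cdot> f) \<cdot> r)"
      using d by simp
    also have "\<dots> = (x \<cdot> a) \<cdot> (f \<cdot> r)"
      using d(1-8) r(1,2) that by simp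
    finally show ?thesis .
  qed
  show "h \<cdot> b = k \<cdot> b"
    using *[OF hk(1,4)] *[OF hk(2,5)] eq by simp
qed

end


section \<open>Adding arrows into an additive bundle\<close>

text \<open>The pointwise sum of two arrows into the total object of \<open>B\<close>; it is meaningful only when
  they lie over the same arrow to the base.\<close>

definition bsum ::
  "('o, 'm, 'x) category_scheme \<Rightarrow> ('m, 'b) bundle_data_scheme \<Rightarrow> 'm \<Rightarrow> 'm \<Rightarrow> 'm" where
  "bsum C B a b = pair2 C B a b \<cdot>\<^bsub>C\<^esub> add B"

definition same_fibre ::
  "('o, 'm, 'x) category_scheme \<Rightarrow> ('m, 'b) bundle_data_scheme \<Rightarrow> 'm \<Rightarrow> 'm \<Rightarrow> bool" where
  "same_fibre C B a b \<longleftrightarrow> a \<in> Ar C \<and> b \<in> Ar C \<and> Dom C a = Dom C b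
     \<and> Cod C a = total_ob C B \<and> Cod C b = total_ob C B \<and> a \<cdot>\<^bsub>C\<^esub> proj B = b \<cdot>\<^bsub>C\<^esub> proj B"

text \<open>What sums of arrows need in order to exist and to lie over the right arrow. It passes from
  the tangent bundle to its image under \<open>T\<close> once \<open>T\<close> preserves the fibre product.\<close>

definition summable_bundle ::
  "('o, 'm, 'x) category_scheme \<Rightarrow> ('m, 'b) bundle_data_scheme \<Rightarrow> bool" where
  "summable_bundle C B \<longleftrightarrow> is_pullback C (pr1 B) (pr2 B) (proj B) (proj B)
     \<and> add B \<in> hom C (Dom C (pr1 B)) (total_ob C B)
     \<and> add B \<cdot>\<^bsub>C\<^esub> proj B = pr1 B \<cdot>\<^bsub>C\<^esub> proj B"

context category
begin

lemma additive_imp_summable: "additive_bundle C B \<Longrightarrow> summable_bundle C B"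
  by (simp add: additive_bundle_def summable_bundle_def)

lemma summableD:
  assumes "summable_bundle C B"
  shows "proj B \<in> Ar C" "Dom C (proj B) = total_ob C B" "pr1 B \<in> Ar C" "pr2 B \<in> Ar C"
    "Dom C (pr2 B) = Dom C (pr1 B)" "Cod C (pr1 B) = total_ob C B" "Cod C (pr2 B) = total_ob C B"
    "add B \<in> Ar C" "Dom C (add B) = Dom C (pr1 B)" "Cod C (add B) = total_ob C B"
    "total_ob C B \<in> Ob C"
  using assms pullbackD[of "pr1 B" "pr2 B" "proj B" "proj B"] dom_in_Ob
  by (auto simp: summable_bundle_def hom_def total_ob_def)

lemma same_fibre_sym: "same_fibre C B a b \<Longrightarrow> same_fibre C B b a"
  by (auto simp: same_fibre_def)

lemma same_fibre_trans: "same_fibre C B a b \<Longrightarrow> same_fibre C B b c \<Longrightarrow> same_fibre C B a c"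
  by (auto simp: same_fibre_def)

lemma same_fibre_comp:
  assumes "summable_bundle C B" "same_fibre C B a b" "k \<in> Ar C" "Cod C k = Dom C a"
  shows "same_fibre C B (k \<cdot> a) (k \<cdot> b)"
  using assms summableD[OF assms(1)] by (auto simp: same_fibre_def)

lemma pair2:
  assumes "summable_bundle C B" "same_fibre C B a b"
  shows "pair2 C B a b \<in> Ar C" "Dom C (pair2 C B a b) = Dom C a"
    "Cod C (pair2 C B a b) = Dom C (pr1 B)" "pair2 C B a b \<cdot> pr1 B = a" "pair2 C B a b \<cdot> pr2 B = b"
  using pairing[of "pr1 B" "pr2 B" "proj B" "proj B" a b] assms
  by (auto simp: summable_bundle_def same_fibre_def pair2_def total_ob_def)

lemma comp_pair2:
  assumes "summable_bundle C B" "same_fibre C B a b" "k \<in> Ar C" "Cod C k = Dom C a"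
  shows "k \<cdot> pair2 C B a b = pair2 C B (k \<cdot> a) (k \<cdot> b)"
  using comp_pairing[of "pr1 B" "pr2 B" "proj B" "proj B" a b k] assms
  by (auto simp: summable_bundle_def same_fibre_def pair2_def total_ob_def)

lemma bsum:
  assumes "summable_bundle C B" "same_fibre C B a b"
  shows "bsum C B a b \<in> Ar C" "Dom C (bsum C B a b) = Dom C a"
    "Cod C (bsum C B a b) = total_ob C B" "bsum C B a b \<cdot> proj B = a \<cdot> proj B"
proof -
  note d = summableD[OF assms(1)] and p = pair2[OF assms]
  show "bsum C B a b \<in> Ar C" "Dom C (bsum C B a b) = Dom C a" "Cod C (bsum C B a b) = total_ob C B"
    using d p by (auto simp: bsum_def)
  have "bsum C B a b \<cdot> proj B = pair2 C B a b \<cdot> (pr1 B \<cdot> proj B)"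
    using d p assms(1) by (simp add: bsum_def summable_bundle_def)
  also have "\<dots> = a \<cdot> proj B"
    using d p comp_cong_left[OF p(4)] by simp
  finally show "bsum C B a b \<cdot> proj B = a \<cdot> proj B" .
qed

lemma same_fibre_bsum:
  assumes "summable_bundle C B" "same_fibre C B a b"
  shows "same_fibre C B (bsum C B a b) a" "same_fibre C B (bsum C B a b) b"
  using bsum[OF assms] assms(2) by (auto simp: same_fibre_def)

lemma comp_bsum:
  assumes "summable_bundle C B" "same_fibre C B a b" "k \<in> Ar C" "Cod C k = Dom C a"
  shows "k \<cdot> bsum C B a b = bsum C B (k \<cdot> a) (k \<cdot> b)"
  using comp_pair2[OF assms] pair2[OF assms(1,2)] summableD[OF assms(1)] assms(3,4)
  by (auto simp: bsum_def simp flip: comp_assoc')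

lemma bsum_commute:
  assumes "additive_bundle C B" "same_fibre C B a b"
  shows "bsum C B a b = bsum C B b a"
proof -
  note s = additive_imp_summable[OF assms(1)]
  note d = summableD[OF s] and p = pair2[OF s assms(2)]
  have pr: "same_fibre C B (pr2 B) (pr1 B)"
    using d assms(1) pullbackD[of "pr1 B" "pr2 B" "proj B" "proj B"]
    by (auto simp: same_fibre_def additive_bundle_def)
  have "bsum C B a b = pair2 C B a b \<cdot> bsum C B (pr2 B) (pr1 B)"
    using assms(1) by (simp add: bsum_def additive_bundle_def)
  also have "\<dots> = bsum C B b a"
    using comp_bsum[OF s pr, of "pair2 C B a b"] p d by simp
  finally show ?thesis .
qed

lemma bsum_zero_left:
  assumes "additive_bundle C B" "a \<in> Ar C" "Cod C a = total_ob C B"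
  shows "bsum C B (a \<cdot> (proj B \<cdot> zero B)) a = a"
    and "same_fibre C B (a \<cdot> (proj B \<cdot> zero B)) a"
proof -
  note s = additive_imp_summable[OF assms(1)]
  note d = summableD[OF s]
  have z: "zero B \<in> Ar C" "Dom C (zero B) = Cod C (proj B)" "Cod C (zero B) = total_ob C B"
    and zp: "zero B \<cdot> proj B = Id C (Cod C (proj B))"
    using assms(1) by (auto simp: additive_bundle_def hom_def base_ob_def)
  have zi: "same_fibre C B (proj B \<cdot> zero B) (Id C (total_ob C B))"
    using d z zp by (auto simp: same_fibre_def)
  show "same_fibre C B (a \<cdot> (proj B \<cdot> zero B)) a"
    using same_fibre_comp[OF s zi, of a] assms d z by simp
  have "bsum C B (a \<cdot> (proj B \<cdot> zero B)) (a \<cdot> Id C (total_ob C B))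
      = a \<cdot> bsum C B (proj B \<cdot> zero B) (Id C (total_ob C B))"
    using comp_bsum[OF s zi, of a] assms(2,3) d z by simp
  also have "\<dots> = a"
    using assms by (simp add: additive_bundle_def bsum_def)
  finally show "bsum C B (a \<cdot> (proj B \<cdot> zero B)) a = a"
    using assms by simp
qed

text \<open>The axiom is stated for the projections of a triple fibre product; as these are generic,
  every triple of arrows over a common base is obtained from them by precomposition.\<close>

lemma bsum_assoc:
  assumes add: "additive_bundle C B" and fp: "is_fibre_power C (proj B) 3 r t"
    and ab: "same_fibre C B a b" and bc: "same_fibre C B b c"
  shows "bsum C B (bsum C B a b) c = bsum C B a (bsum C B b c)"
proof -
  note s = additive_imp_summable[OF add]
  note d = summableD[OF s]
  define y where "y = (\<lambda>i::nat. if i = 0 then a else if i = 1 then b else c)"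
  have "(a \<cdot> proj B) \<in> hom C (Dom C a) (Cod C (proj B))"
    "\<forall>i<3. y i \<in> hom C (Dom C a) (Dom C (proj B)) \<and> y i \<cdot> proj B = a \<cdot> proj B"
    using ab bc d by (auto simp: y_def same_fibre_def hom_def)
  moreover have U: "\<forall>Y c y. c \<in> hom C Y (Cod C (proj B))
      \<and> (\<forall>i<3. y i \<in> hom C Y (Dom C (proj B)) \<and> y i \<cdot> proj B = c) \<longrightarrow>
      (\<exists>!h. h \<in> hom C Y (Dom C t) \<and> h \<cdot> t = c \<and> (\<forall>i<3. h \<cdot> r i = y i))"
    using fp unfolding is_fibre_power_def by (elim conjE)
  ultimately obtain h where h: "h \<in> hom C (Dom C a) (Dom C t)" "\<forall>i<3. h \<cdot> r i = y i"
    using spec[OF spec[OF spec[OF U, of "Dom C a"], of "a \<cdot> proj B"], of y] by blast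
  have h': "h \<in> Ar C" "Cod C h = Dom C t" "h \<cdot> r 0 = a" "h \<cdot> r 1 = b" "h \<cdot> r 2 = c"
    using h by (auto simp: y_def hom_def)
  have r: "r i \<in> Ar C" "Dom C (r i) = Dom C t" if "i < 3" for i
    using fp that by (auto simp: is_fibre_power_def hom_def)
  have rs: "same_fibre C B (r i) (r j)" if "i < 3" "j < 3" for i j
    using fp that d by (auto simp: is_fibre_power_def same_fibre_def hom_def)
  have r01: "same_fibre C B (r 0) (r 1)" and r12: "same_fibre C B (r 1) (r 2)"
    by (rule rs; simp)+
  have R: "Dom C (r 0) = Dom C t" "Dom C (r 1) = Dom C t"
    by (rule r; simp)+
  have r01_2: "same_fibre C B (bsum C B (r 0) (r 1)) (r 2)"
    by (rule same_fibre_trans[OF same_fibre_bsum(2)[OF s r01] r12])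
  have r0_12: "same_fibre C B (r 0) (bsum C B (r 1) (r 2))"
    by (rule same_fibre_trans[OF r01 same_fibre_sym[OF same_fibre_bsum(1)[OF s r12]]])
  have "bsum C B (bsum C B (r 0) (r 1)) (r 2) = bsum C B (r 0) (bsum C B (r 1) (r 2))"
    using add fp unfolding additive_bundle_def bsum_def by blast
  then have "h \<cdot> bsum C B (bsum C B (r 0) (r 1)) (r 2) = h \<cdot> bsum C B (r 0) (bsum C B (r 1) (r 2))"
    by simp
  then show ?thesis
    using comp_bsum[OF s r01_2, of h] comp_bsum[OF s r0_12, of h] comp_bsum[OF s r01, of h]
      comp_bsum[OF s r12, of h] h' R bsum[OF s r01]
    by (simp only: simp_thms)
qed

lemma additive_morphism_bsum:
  assumes "summable_bundle C B" "summable_bundle C B'" "additive_bundle_morphism C B B' f g"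
    and "same_fibre C B a b"
  shows "bsum C B a b \<cdot> g = bsum C B' (a \<cdot> g) (b \<cdot> g)"
    and "same_fibre C B' (a \<cdot> g) (b \<cdot> g)"
proof -
  note d = summableD[OF assms(1)] summableD[OF assms(2)] and p = pair2[OF assms(1,4)]
  have m: "f \<in> Ar C" "Dom C f = Cod C (proj B)" "Cod C f = Cod C (proj B')"
    "g \<in> Ar C" "Dom C g = total_ob C B" "Cod C g = total_ob C B'"
    and mp: "g \<cdot> proj B' = proj B \<cdot> f"
    and ma: "add B \<cdot> g = bsum C B' (pr1 B \<cdot> g) (pr2 B \<cdot> g)"
    using assms(3) by (auto simp: additive_bundle_morphism_def hom_def base_ob_def bsum_def)
  have sf: "same_fibre C B' (x \<cdot> g) (y \<cdot> g)" if "same_fibre C B x y" for x y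
  proof -
    have xy: "x \<in> Ar C" "y \<in> Ar C" "Dom C x = Dom C y" "Cod C x = total_ob C B"
      "Cod C y = total_ob C B" "x \<cdot> proj B = y \<cdot> proj B"
      using that by (auto simp: same_fibre_def)
    have "x \<cdot> (g \<cdot> proj B') = y \<cdot> (g \<cdot> proj B')"
      using comp_cong_left[OF xy(6)] xy d m by (simp add: mp)
    then show ?thesis
      using xy d m by (simp add: same_fibre_def)
  qed
  show "same_fibre C B' (a \<cdot> g) (b \<cdot> g)"
    by (rule sf[OF assms(4)])
  have "same_fibre C B (pr1 B) (pr2 B)"
    using d assms(1) pullbackD[of "pr1 B" "pr2 B" "proj B" "proj B"]
    by (auto simp: same_fibre_def summable_bundle_def)
  note pr = sf[OF this]
  have "bsum C B a b \<cdot> g = pair2 C B a b \<cdot> bsum C B' (pr1 B \<cdot> g) (pr2 B \<cdot> g)"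
    using d p m by (simp add: bsum_def[of C B] ma)
  also have "\<dots> = bsum C B' (pair2 C B a b \<cdot> (pr1 B \<cdot> g)) (pair2 C B a b \<cdot> (pr2 B \<cdot> g))"
    using comp_bsum[OF assms(2) pr, of "pair2 C B a b"] d p m by simp
  also have "\<dots> = bsum C B' (a \<cdot> g) (b \<cdot> g)"
    using comp_cong_left[OF p(4)] comp_cong_left[OF p(5)] d p m by simp
  finally show "bsum C B a b \<cdot> g = bsum C B' (a \<cdot> g) (b \<cdot> g)" .
qed

text \<open>Cancellation allows a difference to be handled through the equation that it solves; a
  negation of the bundle enters only here and in the existence of such solutions.\<close>

lemma bsum_right_cancel:
  assumes add: "additive_bundle C B" and fp: "is_fibre_power C (proj B) 3 r t"
    and nu: "\<nu> \<in> hom C (total_ob C B) (total_ob C B)" "\<nu> \<cdot> proj B = proj B"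
      "bsum C B \<nu> (Id C (total_ob C B)) = proj B \<cdot> zero B"
    and ac: "same_fibre C B a c" and bc: "same_fibre C B b c"
    and eq: "bsum C B a c = bsum C B b c"
  shows "a = b"
proof -
  note s = additive_imp_summable[OF add]
  note d = summableD[OF s]
  have n: "\<nu> \<in> Ar C" "Dom C \<nu> = total_ob C B" "Cod C \<nu> = total_ob C B"
    using nu(1) by (auto simp: hom_def)
  have ni: "same_fibre C B \<nu> (Id C (total_ob C B))"
    using n d nu(2) by (simp add: same_fibre_def)
  have *: "bsum C B (c \<cdot> \<nu>) (bsum C B a c) = a" if "same_fibre C B a c" for a
  proof -
    have c: "c \<in> Ar C" "Cod C c = total_ob C B" "a \<in> Ar C" "Cod C a = total_ob C B"
      "c \<cdot> proj B = a \<cdot> proj B"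
      using that by (auto simp: same_fibre_def)
    have z: "zero B \<in> Ar C" "Dom C (zero B) = Cod C (proj B)"
      using add by (auto simp: additive_bundle_def hom_def base_ob_def)
    have nc: "same_fibre C B (c \<cdot> \<nu>) c"
      using same_fibre_comp[OF s ni, of c] c n by simp
    have "bsum C B (c \<cdot> \<nu>) (bsum C B a c) = bsum C B (bsum C B (c \<cdot> \<nu>) c) a"
      using bsum_commute[OF add that] bsum_assoc[OF add fp nc same_fibre_sym[OF that]] by simp
    moreover have "bsum C B (c \<cdot> \<nu>) c = c \<cdot> (proj B \<cdot> zero B)"
      using comp_bsum[OF s ni, of c] c n by (simp add: nu(3))
    moreover have "c \<cdot> (proj B \<cdot> zero B) = a \<cdot> (proj B \<cdot> zero B)"
      using comp_cong_left[OF c(5)] c z d by simp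
    ultimately show ?thesis
      using bsum_zero_left(1)[OF add c(3,4)] by (simp only:)
  qed
  show ?thesis
    by (rule trans[OF sym[OF *[OF ac, unfolded eq]] *[OF bc]])
qed

end


section \<open>Complements in the tangent bundle\<close>

abbreviation tsum ::
  "('o, 'm, 'x) tangent_category_scheme \<Rightarrow> 'o \<Rightarrow> 'm \<Rightarrow> 'm \<Rightarrow> 'm" where
  "tsum X E \<equiv> bsum X (tangent_bundle X E)"

abbreviation same_base ::
  "('o, 'm, 'x) tangent_category_scheme \<Rightarrow> 'o \<Rightarrow> 'm \<Rightarrow> 'm \<Rightarrow> bool" where
  "same_base X E \<equiv> same_fibre X (tangent_bundle X E)"

lemma tangent_bundle_sel [simp]:
  "proj (tangent_bundle X M) = T_proj X M" "zero (tangent_bundle X M) = T_zero X M"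
  "add (tangent_bundle X M) = T_sum X M" "pr1 (tangent_bundle X M) = T_pr1 X M"
  "pr2 (tangent_bundle X M) = T_pr2 X M" "lift (tangent_bundle X M) = T_lift X M"
  by (simp_all add: tangent_bundle_def)

lemma T_bundle_sel [simp]:
  "proj (T_bundle X B) = T_ar X (proj B)" "zero (T_bundle X B) = T_ar X (zero B)"
  "add (T_bundle X B) = T_ar X (add B)" "pr1 (T_bundle X B) = T_ar X (pr1 B)"
  "pr2 (T_bundle X B) = T_ar X (pr2 B)"
  by (simp_all add: T_bundle_def)

context tangent_category
begin

lemma Ob_closed [simp]:
  "M \<in> Ob X \<Longrightarrow> T_ob X M \<in> Ob X" "f \<in> Ar X \<Longrightarrow> Dom X f \<in> Ob X" "f \<in> Ar X \<Longrightarrow> Cod X f \<in> Ob X"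
  using T_ob dom_in_Ob cod_in_Ob by auto

lemma T_arr [simp]:
  assumes "f \<in> Ar X"
  shows "T_ar X f \<in> Ar X" "Dom X (T_ar X f) = T_ob X (Dom X f)" "Cod X (T_ar X f) = T_ob X (Cod X f)"
  using T_ar[of f "Dom X f" "Cod X f"] assms by (auto simp: hom_def)

lemma T_comp' [simp]:
  "f \<in> Ar X \<Longrightarrow> g \<in> Ar X \<Longrightarrow> Cod X f = Dom X g \<Longrightarrow> T_ar X (f \<cdot> g) = T_ar X f \<cdot> T_ar X g"
  using T_comp[of f "Dom X f" "Cod X f" g "Cod X g"] by (auto simp: hom_def)

lemma structure_arr [simp]:
  assumes "M \<in> Ob X"
  shows "T_proj X M \<in> Ar X" "Dom X (T_proj X M) = T_ob X M" "Cod X (T_proj X M) = M"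
    "T_zero X M \<in> Ar X" "Dom X (T_zero X M) = M" "Cod X (T_zero X M) = T_ob X M"
    "T_lift X M \<in> Ar X" "Dom X (T_lift X M) = T_ob X M" "Cod X (T_lift X M) = T_ob X (T_ob X M)"
    "T_flip X M \<in> Ar X" "Dom X (T_flip X M) = T_ob X (T_ob X M)"
    "Cod X (T_flip X M) = T_ob X (T_ob X M)"
    "T_zero X M \<cdot> T_proj X M = Id X M"
proof -
  have p: "T_proj X M \<in> Ar X" "Dom X (T_proj X M) = T_ob X M" "Cod X (T_proj X M) = M"
    using proj_in_hom[OF assms] by (auto simp: hom_def)
  then show "T_proj X M \<in> Ar X" "Dom X (T_proj X M) = T_ob X M" "Cod X (T_proj X M) = M"
    by auto
  show "T_zero X M \<in> Ar X" "Dom X (T_zero X M) = M" "Cod X (T_zero X M) = T_ob X M"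
    "T_zero X M \<cdot> T_proj X M = Id X M"
    using additive[OF assms] p
    by (auto simp: additive_bundle_def hom_def base_ob_def total_ob_def)
  show "T_lift X M \<in> Ar X" "Dom X (T_lift X M) = T_ob X M" "Cod X (T_lift X M) = T_ob X (T_ob X M)"
    using lift_in_hom[OF assms] by (auto simp: hom_def)
  show "T_flip X M \<in> Ar X" "Dom X (T_flip X M) = T_ob X (T_ob X M)"
    "Cod X (T_flip X M) = T_ob X (T_ob X M)"
    using flip_in_hom[OF assms] by (auto simp: hom_def)
qed

lemma tangent_bundle_obs [simp]:
  assumes "M \<in> Ob X"
  shows "total_ob X (tangent_bundle X M) = T_ob X M" "base_ob X (tangent_bundle X M) = M"
    "total_ob X (T_bundle X (tangent_bundle X M)) = T_ob X (T_ob X M)"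
    "base_ob X (T_bundle X (tangent_bundle X M)) = T_ob X M"
  using assms by (simp_all add: total_ob_def base_ob_def)

lemma same_base_iff:
  assumes "E \<in> Ob X"
  shows "same_base X E a b \<longleftrightarrow> a \<in> Ar X \<and> b \<in> Ar X \<and> Dom X a = Dom X b
     \<and> Cod X a = T_ob X E \<and> Cod X b = T_ob X E \<and> a \<cdot> T_proj X E = b \<cdot> T_proj X E"
  using assms by (simp add: same_fibre_def)

lemma tangent_summable: "M \<in> Ob X \<Longrightarrow> summable_bundle X (tangent_bundle X M)"
  by (rule additive_imp_summable[OF additive])

lemma T_tangent_summable:
  assumes "M \<in> Ob X"
  shows "summable_bundle X (T_bundle X (tangent_bundle X M))"
proof -
  note d = summableD[OF tangent_summable[OF assms]]
  have "is_pullback X (T_ar X (T_pr1 X M)) (T_ar X (T_pr2 X M))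
      (T_ar X (T_proj X M)) (T_ar X (T_proj X M))"
    using T2_pullback[OF assms] unfolding tangent_pullback_def
    by (elim allE[of _ "Suc 0"]) simp
  moreover have "T_ar X (T_sum X M \<cdot> T_proj X M) = T_ar X (T_pr1 X M \<cdot> T_proj X M)"
    using tangent_summable[OF assms] by (simp add: summable_bundle_def)
  ultimately show ?thesis
    using d assms by (simp add: summable_bundle_def hom_def)
qed

lemma T_tsum:
  assumes E: "E \<in> Ob X" and ab: "same_base X E a b"
  shows "T_ar X (tsum X E a b) = bsum X (T_bundle X (tangent_bundle X E)) (T_ar X a) (T_ar X b)"
    and "same_fibre X (T_bundle X (tangent_bundle X E)) (T_ar X a) (T_ar X b)"
proof -
  let ?TB = "T_bundle X (tangent_bundle X E)"
  note s = tangent_summable[OF E] and s' = T_tangent_summable[OF E]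
  note d = summableD[OF s] and d' = summableD[OF s'] and p = pair2[OF s ab]
  have "T_ar X (pair2 X (tangent_bundle X E) a b \<cdot> T_pr1 X E) = T_ar X a"
    "T_ar X (pair2 X (tangent_bundle X E) a b \<cdot> T_pr2 X E) = T_ar X b"
    using p by simp_all
  then have "T_ar X (pair2 X (tangent_bundle X E) a b) \<cdot> T_ar X (T_pr1 X E) = T_ar X a"
    "T_ar X (pair2 X (tangent_bundle X E) a b) \<cdot> T_ar X (T_pr2 X E) = T_ar X b"
    using p(1-3) d by simp_all
  then have "T_ar X (pair2 X (tangent_bundle X E) a b) = pair2 X ?TB (T_ar X a) (T_ar X b)"
    using p d d' s' unfolding pair2_def[of X ?TB] summable_bundle_def
    by (intro pairing_unique[symmetric]) auto
  then show "T_ar X (tsum X E a b) = bsum X ?TB (T_ar X a) (T_ar X b)"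
    using p d by (simp add: bsum_def)
  have x: "a \<in> Ar X" "b \<in> Ar X" "Dom X a = Dom X b" "Cod X a = T_ob X E" "Cod X b = T_ob X E"
    using ab E by (auto simp: same_base_iff)
  have "T_ar X (a \<cdot> T_proj X E) = T_ar X (b \<cdot> T_proj X E)"
    using ab E by (simp add: same_base_iff)
  then show "same_fibre X ?TB (T_ar X a) (T_ar X b)"
    using x E by (simp add: same_fibre_def)
qed

lemma tsum_T:
  assumes "f \<in> Ar X" "same_base X (Dom X f) a b"
  shows "tsum X (Dom X f) a b \<cdot> T_ar X f = tsum X (Cod X f) (a \<cdot> T_ar X f) (b \<cdot> T_ar X f)"
    and "same_base X (Cod X f) (a \<cdot> T_ar X f) (b \<cdot> T_ar X f)"
proof -
  have f: "f \<in> hom X (Dom X f) (Cod X f)"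
    using assms(1) by (simp add: hom_def)
  have "additive_bundle_morphism X (tangent_bundle X (Dom X f)) (tangent_bundle X (Cod X f))
      f (T_ar X f)"
    using f T_ar[OF f] proj_natural[OF f] zero_natural[OF f] sum_natural[OF f] assms(1)
    by (simp add: additive_bundle_morphism_def)
  note additive_morphism_bsum[OF tangent_summable tangent_summable this assms(2)]
  then show "tsum X (Dom X f) a b \<cdot> T_ar X f = tsum X (Cod X f) (a \<cdot> T_ar X f) (b \<cdot> T_ar X f)"
    "same_base X (Cod X f) (a \<cdot> T_ar X f) (b \<cdot> T_ar X f)"
    using assms(1) by simp_all
qed

lemma T_tsum_flip:
  assumes "E \<in> Ob X" "same_fibre X (T_bundle X (tangent_bundle X E)) a b"
  shows "bsum X (T_bundle X (tangent_bundle X E)) a b \<cdot> T_flip X E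
      = tsum X (T_ob X E) (a \<cdot> T_flip X E) (b \<cdot> T_flip X E)"
    and "same_base X (T_ob X E) (a \<cdot> T_flip X E) (b \<cdot> T_flip X E)"
  using additive_morphism_bsum[OF T_tangent_summable tangent_summable flip_additive assms(2)]
    assms(1) by simp_all

text \<open>The lift is additive for \<open>T p\<close> by axiom; the flip exchanges \<open>T p\<close> with the tangent bundle of
  \<open>T E\<close> and fixes the lift.\<close>

lemma tsum_lift:
  assumes E: "E \<in> Ob X" and ab: "same_base X E a b"
  shows "tsum X E a b \<cdot> T_lift X E = tsum X (T_ob X E) (a \<cdot> T_lift X E) (b \<cdot> T_lift X E)"
    and "same_base X (T_ob X E) (a \<cdot> T_lift X E) (b \<cdot> T_lift X E)"
proof -
  note m = additive_morphism_bsum[OF tangent_summable[OF E] T_tangent_summable[OF E]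
      lift_additive[OF E] ab]
  have lc: "(x \<cdot> T_lift X E) \<cdot> T_flip X E = x \<cdot> T_lift X E" if "x \<in> Ar X" "Cod X x = T_ob X E" for x
    using that E lift_flip[OF E] by simp
  have x: "a \<in> Ar X" "Cod X a = T_ob X E" "b \<in> Ar X" "Cod X b = T_ob X E"
    using ab E by (auto simp: same_base_iff)
  note t = bsum[OF tangent_summable[OF E] ab, unfolded tangent_bundle_obs[OF E]]
  show "same_base X (T_ob X E) (a \<cdot> T_lift X E) (b \<cdot> T_lift X E)"
    using T_tsum_flip(2)[OF E m(2)] by (simp only: lc[OF x(1,2)] lc[OF x(3,4)])
  have "tsum X E a b \<cdot> T_lift X E = (tsum X E a b \<cdot> T_lift X E) \<cdot> T_flip X E"
    by (rule lc[OF t(1,3), symmetric])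
  then show "tsum X E a b \<cdot> T_lift X E = tsum X (T_ob X E) (a \<cdot> T_lift X E) (b \<cdot> T_lift X E)"
    by (simp only: m(1) T_tsum_flip(1)[OF E m(2)] lc[OF x(1,2)] lc[OF x(3,4)])
qed

end

locale tangent_category_with_negatives = tangent_category +
  assumes negatives: "has_negatives X"
begin

lemma negation_exists:
  assumes E: "E \<in> Ob X"
  obtains n where "n \<in> hom X (T_ob X E) (T_ob X E)" "n \<cdot> T_proj X E = T_proj X E"
    "tsum X E n (Id X (T_ob X E)) = T_proj X E \<cdot> T_zero X E"
  using negatives E unfolding has_negatives_def bsum_def by auto

lemma triple_fibre_power:
  assumes E: "E \<in> Ob X"
  obtains r t where "is_fibre_power X (proj (tangent_bundle X E)) 3 r t"
proof -
  obtain r t where "\<forall>m. is_fibre_power X ((T_ar X ^^ m) (T_proj X E)) 3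
        (\<lambda>i. (T_ar X ^^ m) (r i)) ((T_ar X ^^ m) t)"
    using fibre_powers[OF E] unfolding has_tangent_fibre_powers_def by blast
  from this[rule_format, of 0] show ?thesis
    using that by simp
qed

lemma tsum_right_cancel:
  assumes E: "E \<in> Ob X" and "same_base X E a c" "same_base X E b c"
    and "tsum X E a c = tsum X E b c"
  shows "a = b"
proof -
  obtain n where n: "n \<in> hom X (T_ob X E) (T_ob X E)" "n \<cdot> T_proj X E = T_proj X E"
    "tsum X E n (Id X (T_ob X E)) = T_proj X E \<cdot> T_zero X E"
    by (rule negation_exists[OF E])
  obtain r t where "is_fibre_power X (proj (tangent_bundle X E)) 3 r t"
    by (rule triple_fibre_power[OF E])
  from bsum_right_cancel[OF additive[OF E] this _ _ _ assms(2-4), of n] n E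
  show ?thesis by simp
qed

text \<open>The difference \<open>id - f\<close>, obtained as \<open>id + f n\<close> for the negation \<open>n\<close>.\<close>

lemma complement_exists:
  assumes E: "E \<in> Ob X" and f: "f \<in> hom X (T_ob X E) (T_ob X E)" "f \<cdot> T_proj X E = T_proj X E"
  obtains \<phi> where "same_base X E \<phi> f" "\<phi> \<cdot> T_proj X E = T_proj X E"
    "\<phi> \<in> hom X (T_ob X E) (T_ob X E)" "tsum X E \<phi> f = Id X (T_ob X E)"
proof -
  obtain n where n: "n \<in> hom X (T_ob X E) (T_ob X E)" "n \<cdot> T_proj X E = T_proj X E"
    "tsum X E n (Id X (T_ob X E)) = T_proj X E \<cdot> T_zero X E"
    by (rule negation_exists[OF E])
  obtain r t where fp: "is_fibre_power X (proj (tangent_bundle X E)) 3 r t"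
    by (rule triple_fibre_power[OF E])
  let ?I = "Id X (T_ob X E)"
  note s = tangent_summable[OF E] and add = additive[OF E]
  have If: "same_base X E ?I (f \<cdot> n)" and nf: "same_base X E (f \<cdot> n) f" and ni: "same_base X E n ?I"
    using f n E by (auto simp: same_base_iff hom_def)
  let ?\<phi> = "tsum X E ?I (f \<cdot> n)"
  have sf: "same_base X E ?\<phi> f"
    by (rule same_fibre_trans[OF same_fibre_bsum(2)[OF s If] nf])
  have "tsum X E (f \<cdot> n) f = f \<cdot> tsum X E n ?I"
    using comp_bsum[OF s ni, of f] f n by (simp add: hom_def)
  also have "\<dots> = ?I \<cdot> (T_proj X E \<cdot> T_zero X E)"
    using comp_cong_left[OF f(2), of "T_zero X E"] f(1) E by (simp add: n(3) hom_def)
  finally have nf0: "tsum X E (f \<cdot> n) f = ?I \<cdot> (T_proj X E \<cdot> T_zero X E)" .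
  have sz: "same_base X E ?I (?I \<cdot> (T_proj X E \<cdot> T_zero X E))"
    using bsum_zero_left(2)[OF add, of ?I] E same_fibre_sym by simp
  have "tsum X E ?\<phi> f = tsum X E ?I (tsum X E (f \<cdot> n) f)"
    by (rule bsum_assoc[OF add fp If nf])
  also have "\<dots> = tsum X E (?I \<cdot> (T_proj X E \<cdot> T_zero X E)) ?I"
    unfolding nf0 by (rule bsum_commute[OF add sz])
  also have "\<dots> = ?I"
    using bsum_zero_left(1)[OF add, of ?I] E by simp
  finally have "tsum X E ?\<phi> f = ?I" .
  moreover have "?\<phi> \<cdot> T_proj X E = T_proj X E" "?\<phi> \<in> hom X (T_ob X E) (T_ob X E)"
    using bsum[OF s If] E by (simp_all add: hom_def)
  ultimately show ?thesis
    using that sf by blast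
qed

text \<open>Lifting \<open>\<phi> + f = id\<close> inside the tangent bundle of \<open>T E\<close> gives \<open>\<phi> l + f l = l\<close>. Applying \<open>T\<close> to
  the same equation gives a sum for \<open>T(p)\<close>; the flip \<open>c\<close> carries it over to the tangent bundle of
  \<open>T E\<close>, and precomposing with \<open>l\<close> yields \<open>l T(\<phi>) c + l T(f) c = l\<close>, as \<open>l c = l\<close>. The linearity of \<open>f\<close>
  makes the second summands equal, so \<open>\<phi> l = l T(\<phi>) c\<close>, and one more flip removes \<open>c\<close>.\<close>

lemma complement_linear:
  assumes E: "E \<in> Ob X" and sf: "same_base X E \<phi> f" and dom: "Dom X f = T_ob X E"
    and id: "tsum X E \<phi> f = Id X (T_ob X E)"
    and lin: "f \<cdot> T_lift X E = T_lift X E \<cdot> T_ar X f"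
  shows "\<phi> \<cdot> T_lift X E = T_lift X E \<cdot> T_ar X \<phi>"
proof -
  let ?l = "T_lift X E" and ?c = "T_flip X E" and ?TE = "T_ob X E"
  have x: "f \<in> Ar X" "\<phi> \<in> Ar X" "Dom X \<phi> = ?TE" "Cod X f = ?TE" "Cod X \<phi> = ?TE"
    using sf E dom by (auto simp: same_base_iff)
  have lc: "?l \<cdot> (?c \<cdot> h) = ?l \<cdot> h" if "h \<in> Ar X" "Dom X h = T_ob X ?TE" for h
    using comp_cong_left[OF lift_flip[OF E]] E that by simp
  have 1: "?l = tsum X ?TE (\<phi> \<cdot> ?l) (f \<cdot> ?l)" and s1: "same_base X ?TE (\<phi> \<cdot> ?l) (f \<cdot> ?l)"
    using tsum_lift[OF E sf] E by (simp_all add: id)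
  note T = T_tsum[OF E sf]
  note fl = T_tsum_flip[OF E T(2)]
  have "T_ar X (tsum X E \<phi> f) = Id X (T_ob X ?TE)"
    using E T_id[of ?TE] by (simp add: id)
  then have c: "?c = tsum X ?TE (T_ar X \<phi> \<cdot> ?c) (T_ar X f \<cdot> ?c)"
    using fl(1) E by (simp add: T(1))
  have lTf: "?l \<cdot> (T_ar X f \<cdot> ?c) = f \<cdot> ?l"
  proof -
    have "?l \<cdot> (T_ar X f \<cdot> ?c) = (?l \<cdot> T_ar X f) \<cdot> ?c"
      using x E dom by simp
    also have "\<dots> = (f \<cdot> ?l) \<cdot> ?c"
      by (simp only: lin)
    also have "\<dots> = f \<cdot> ?l"
      using x E dom lift_flip[OF E] by simp
    finally show ?thesis .
  qed
  have s: "?TE \<in> Ob X" using E by simp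
  have dl: "Cod X ?l = Dom X (T_ar X \<phi> \<cdot> ?c)" "?l \<in> Ar X"
    using x E by simp_all
  have "?l \<cdot> ?c = ?l \<cdot> tsum X ?TE (T_ar X \<phi> \<cdot> ?c) (T_ar X f \<cdot> ?c)"
    using c by (rule arg_cong)
  then have 2: "?l = tsum X ?TE (?l \<cdot> (T_ar X \<phi> \<cdot> ?c)) (f \<cdot> ?l)"
    unfolding comp_bsum[OF tangent_summable[OF s] fl(2) dl(2,1)] lTf lift_flip[OF E] .
  have s2: "same_base X ?TE (?l \<cdot> (T_ar X \<phi> \<cdot> ?c)) (f \<cdot> ?l)"
    using same_fibre_comp[OF tangent_summable[OF s] fl(2) dl(2,1)] unfolding lTf .
  have *: "\<phi> \<cdot> ?l = ?l \<cdot> (T_ar X \<phi> \<cdot> ?c)"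
    by (rule tsum_right_cancel[OF s s1 s2]) (simp only: 1[symmetric] 2[symmetric])
  have "\<phi> \<cdot> ?l = (\<phi> \<cdot> ?l) \<cdot> ?c"
    using x E lift_flip[OF E] by simp
  also have "\<dots> = ?l \<cdot> T_ar X \<phi>"
    unfolding * using x E flip_flip[OF E] by simp
  finally show ?thesis .
qed

end


section \<open>Linear morphisms over a fixed base\<close>

context tangent_category
begin

lemma differential_bundleD:
  assumes "differential_bundle X B"
  shows "proj B \<in> Ar X" "Dom X (proj B) = total_ob X B" "Cod X (proj B) = base_ob X B"
    "total_ob X B \<in> Ob X" "base_ob X B \<in> Ob X"
    "zero B \<in> Ar X" "Dom X (zero B) = base_ob X B" "Cod X (zero B) = total_ob X B"
    "lift B \<in> Ar X" "Dom X (lift B) = total_ob X B" "Cod X (lift B) = T_ob X (total_ob X B)"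
    "zero B \<cdot> proj B = Id X (base_ob X B)"
    "lift B \<cdot> T_proj X (total_ob X B) = proj B \<cdot> zero B"
    "zero B \<cdot> lift B = zero B \<cdot> T_zero X (total_ob X B)"
proof -
  have add: "additive_bundle X B"
    and l: "lift B \<in> hom X (total_ob X B) (T_ob X (total_ob X B))"
    and m: "additive_bundle_morphism X B (tangent_bundle X (total_ob X B)) (zero B) (lift B)"
    using assms by (auto simp: differential_bundle_def)
  show p: "proj B \<in> Ar X" "Dom X (proj B) = total_ob X B" "Cod X (proj B) = base_ob X B"
    and o: "total_ob X B \<in> Ob X"
    using summableD[OF additive_imp_summable[OF add]] by (simp_all add: base_ob_def)
  show "base_ob X B \<in> Ob X"
    using cod_in_Ob[OF p(1)] by (simp add: base_ob_def)
  show "zero B \<in> Ar X" "Dom X (zero B) = base_ob X B" "Cod X (zero B) = total_ob X B"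
    "zero B \<cdot> proj B = Id X (base_ob X B)"
    using add by (simp_all add: additive_bundle_def hom_def)
  show "lift B \<in> Ar X" "Dom X (lift B) = total_ob X B" "Cod X (lift B) = T_ob X (total_ob X B)"
    using l by (simp_all add: hom_def)
  show "lift B \<cdot> T_proj X (total_ob X B) = proj B \<cdot> zero B"
    "zero B \<cdot> lift B = zero B \<cdot> T_zero X (total_ob X B)"
    using m by (simp_all add: additive_bundle_morphism_def)
qed

lemma linearD:
  assumes "linear_morphism X B B' (Id X E) f" "differential_bundle X B" "base_ob X B = E"
  shows "f \<in> Ar X" "Dom X f = total_ob X B" "Cod X f = total_ob X B'"
    "f \<cdot> proj B' = proj B" "f \<cdot> lift B' = lift B \<cdot> T_ar X f"
  using assms differential_bundleD[OF assms(2)] by (auto simp: linear_morphism_def hom_def)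

lemma linear_comp:
  assumes f: "linear_morphism X B B' (Id X E) f" and g: "linear_morphism X B' B'' (Id X E) g"
    and B: "differential_bundle X B" "base_ob X B = E"
    and B': "differential_bundle X B'" "base_ob X B' = E"
    and B'': "differential_bundle X B''" "base_ob X B'' = E"
  shows "linear_morphism X B B'' (Id X E) (f \<cdot> g)"
proof -
  note F = linearD[OF f B] and G = linearD[OF g B']
  note d = differential_bundleD[OF B(1)] differential_bundleD[OF B'(1)]
    differential_bundleD[OF B''(1)]
  have "(f \<cdot> g) \<cdot> proj B'' = proj B"
    using F G d by simp
  moreover have "(f \<cdot> g) \<cdot> lift B'' = lift B \<cdot> T_ar X (f \<cdot> g)"
  proof -
    have "(f \<cdot> g) \<cdot> lift B'' = (f \<cdot> lift B') \<cdot> T_ar X g"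
      using F(1-4) G d by simp
    also have "\<dots> = lift B \<cdot> T_ar X (f \<cdot> g)"
      using F G(1-3) d by simp
    finally show ?thesis .
  qed
  ultimately show ?thesis
    using F(1-3) G(1-3) d B(2) B''(2) by (auto simp: linear_morphism_def hom_def)
qed

text \<open>Let \<open>z\<close>, \<open>z'\<close> and \<open>l\<close>, \<open>l'\<close> be the zeros and lifts of the two bundles. Lifting a zero vector
  gives the zero tangent vector there, so linearity of \<open>f\<close> and naturality of the tangent zero show
  that \<open>z f l'\<close> is the zero tangent vector at \<open>z f\<close>. Its foot is therefore \<open>z f\<close>, whereas every
  lift \<open>l'\<close> has its foot on \<open>z'\<close>.\<close>

lemma linear_preserves_zero:
  assumes f: "linear_morphism X B B' (Id X E) f"
    and B: "differential_bundle X B" "base_ob X B = E"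
    and B': "differential_bundle X B'" "base_ob X B' = E"
  shows "zero B \<cdot> f = zero B'"
proof -
  note F = linearD[OF f B] and d = differential_bundleD[OF B(1)]
    and d' = differential_bundleD[OF B'(1)]
  let ?A = "total_ob X B" and ?A' = "total_ob X B'"
  have nat: "f \<cdot> T_zero X ?A' = T_zero X ?A \<cdot> T_ar X f"
    using zero_natural[of f ?A ?A'] F by (simp add: hom_def)
  have "(zero B \<cdot> f) \<cdot> lift B' = zero B \<cdot> (lift B \<cdot> T_ar X f)"
    using F d d' by simp
  also have "\<dots> = zero B \<cdot> (T_zero X ?A \<cdot> T_ar X f)"
    using comp_cong_left[OF d(14)] F(1-3) d(1-13) by simp
  also have "\<dots> = (zero B \<cdot> f) \<cdot> T_zero X ?A'"
    using F(1-3) d(1-13) d' by (simp add: nat)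
  finally have eq: "(zero B \<cdot> f) \<cdot> lift B' = (zero B \<cdot> f) \<cdot> T_zero X ?A'" .
  have "((zero B \<cdot> f) \<cdot> lift B') \<cdot> T_proj X ?A' = (zero B \<cdot> f) \<cdot> (proj B' \<cdot> zero B')"
    using F(1-3) d(1-13) d' by simp
  also have "\<dots> = (zero B \<cdot> (f \<cdot> proj B')) \<cdot> zero B'"
    using F(1-3) d(1-13) d'(1-12) B B' by simp
  also have "\<dots> = zero B'"
    using F(4) d(1-13) d'(1-12) B B' by simp
  finally have "((zero B \<cdot> f) \<cdot> lift B') \<cdot> T_proj X ?A' = zero B'" .
  moreover have "((zero B \<cdot> f) \<cdot> T_zero X ?A') \<cdot> T_proj X ?A' = zero B \<cdot> f"
    using F(1-3) d(1-13) d'(1-12) by simp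
  ultimately show ?thesis
    unfolding eq by simp
qed

end


section \<open>Connections on a submersion\<close>

locale submersion_with_negatives = tangent_category_with_negatives X
  for X :: "('o, 'm, 'x) tangent_category_scheme" (structure) +
  fixes q :: 'm and V :: "'m lifted_bundle" and \<iota> tV :: 'm and F :: "'m lifted_bundle" and tF :: 'm
  assumes submersion: "submersion X q V \<iota> tV F tF"
begin

abbreviation "E \<equiv> Dom X q"
abbreviation "M \<equiv> Cod X q"
abbreviation "TE \<equiv> T_ob X E"
abbreviation "P \<equiv> tangent_bundle X E"
abbreviation "Z \<equiv> trivial_bundle X E"
abbreviation "p \<equiv> T_proj X E"
abbreviation "z \<equiv> T_zero X E"
abbreviation "\<pi> \<equiv> horizontal_descent X q F tF"

lemma q [simp]: "q \<in> Ar X"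
  using submersion by (simp add: submersion_def tangent_display_map_def)

lemma vertical: "vertical_bundle X q V \<iota> tV"
  using submersion by (simp add: submersion_def)

lemma finsler: "finsler_bundle X q F tF"
  using submersion by (simp add: submersion_def)

lemma pushout: "is_pushout (DB X E) (V, \<iota>, P) (V, proj V, Z) (P, \<pi>, F) (Z, zero F, F)"
  using submersion by (simp add: submersion_def Let_def)

lemma bundles:
  shows V: "differential_bundle X V" "base_ob X V = E"
    and P: "differential_bundle X P" "base_ob X P = E"
    and Z: "differential_bundle X Z" "base_ob X Z = E"
    and F: "differential_bundle X F" "base_ob X F = E"
  using pushout by (auto simp: is_pushout_def DB_def hom_def)

lemma square_linear:
  "linear_morphism X V P (Id X E) \<iota>" "linear_morphism X V Z (Id X E) (proj V)"
  "linear_morphism X P F (Id X E) \<pi>" "linear_morphism X Z F (Id X E) (zero F)"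
  using pushout by (auto simp: is_pushout_def DB_def hom_def)

lemmas V_arr [simp] = differential_bundleD(1-11)[OF V(1), unfolded V(2)]
lemmas F_arr [simp] = differential_bundleD(1-11)[OF F(1), unfolded F(2)]

lemma E_M [simp]: "E \<in> Ob X" "M \<in> Ob X"
  by simp_all

lemma Z_simps [simp]: "total_ob X Z = E" "proj Z = Id X E" "lift Z = z" "zero Z = Id X E"
  by (simp_all add: trivial_bundle_def total_ob_def)

lemma \<iota> [simp]: "\<iota> \<in> Ar X" "Dom X \<iota> = total_ob X V" "Cod X \<iota> = TE"
  and \<iota>_p: "\<iota> \<cdot> p = proj V" and \<iota>_lift: "\<iota> \<cdot> T_lift X E = lift V \<cdot> T_ar X \<iota>"
  using linearD[OF square_linear(1) V] by simp_all

lemma \<pi> [simp]: "\<pi> \<in> Ar X" "Dom X \<pi> = TE" "Cod X \<pi> = total_ob X F"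
  and \<pi>_projF: "\<pi> \<cdot> proj F = p"
  using linearD[OF square_linear(3) P] by simp_all

lemma square: "\<iota> \<cdot> \<pi> = proj V \<cdot> zero F"
  using pushout by (auto simp: is_pushout_def DB_def)

lemma V_pullback:
  "is_pullback X \<iota> tV (T_ar X q) (T_zero X M)"
  "is_pullback X (T_ar X \<iota>) (T_ar X tV) (T_ar X (T_ar X q)) (T_ar X (T_zero X M))"
proof -
  have "tangent_pullback X \<iota> tV (T_ar X q) (T_zero X M)"
    using vertical by (simp add: vertical_bundle_def Let_def)
  note this[unfolded tangent_pullback_def, rule_format]
  from this[of 0] this[of "Suc 0"]
  show "is_pullback X \<iota> tV (T_ar X q) (T_zero X M)"
    "is_pullback X (T_ar X \<iota>) (T_ar X tV) (T_ar X (T_ar X q)) (T_ar X (T_zero X M))"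
    by simp_all
qed

lemma F_pullback: "is_pullback X (proj F) tF q (T_proj X M)"
proof -
  have "tangent_pullback X (proj F) tF q (T_proj X M)"
    using finsler by (simp add: finsler_bundle_def Let_def)
  note this[unfolded tangent_pullback_def, rule_format, of 0]
  then show ?thesis by simp
qed

lemma tV [simp]: "tV \<in> Ar X" "Dom X tV = total_ob X V" "Cod X tV = M"
  using pullbackD[OF V_pullback(1)] by simp_all

lemma tF [simp]: "tF \<in> Ar X" "Dom X tF = total_ob X F" "Cod X tF = T_ob X M"
  using pullbackD[OF F_pullback] by simp_all

lemma \<pi>_tF: "\<pi> \<cdot> tF = T_ar X q"
proof -
  have "T_ar X q \<cdot> T_proj X M = p \<cdot> q"
    using proj_natural[of q E M] by (simp add: hom_def)
  then show ?thesis
    unfolding horizontal_descent_def by (intro pairing[OF F_pullback]) simp_all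
qed

lemma zeroV_\<iota>: "zero V \<cdot> \<iota> = z"
  using vertical by (simp add: vertical_bundle_def Let_def)

lemma \<iota>_mono:
  assumes "h \<in> Ar X" "k \<in> Ar X" "Dom X h = Dom X k" "Cod X h = total_ob X V"
    "Cod X k = total_ob X V" "h \<cdot> \<iota> = k \<cdot> \<iota>"
  shows "h = k"
  by (rule pullback_of_split_mono_is_mono[OF V_pullback(1), of "T_proj X M"]) (use assms in simp_all)

lemma T\<iota>_mono:
  assumes "h \<in> Ar X" "k \<in> Ar X" "Dom X h = Dom X k" "Cod X h = T_ob X (total_ob X V)"
    "Cod X k = T_ob X (total_ob X V)" "h \<cdot> T_ar X \<iota> = k \<cdot> T_ar X \<iota>"
  shows "h = k"
proof (rule pullback_of_split_mono_is_mono[OF V_pullback(2), of "T_ar X (T_proj X M)"])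
  have "T_ar X (T_zero X M) \<cdot> T_ar X (T_proj X M) = T_ar X (T_zero X M \<cdot> T_proj X M)"
    by (simp del: structure_arr(13))
  then show "T_ar X (T_zero X M) \<cdot> T_ar X (T_proj X M) = Id X (Dom X (T_ar X (T_zero X M)))"
    using T_id[of M] by simp
qed (use assms in simp_all)

text \<open>The universal property of the submersion, with the triples that are the arrows of the
  category of differential bundles over \<open>E\<close> replaced by their underlying arrows.\<close>

lemma pushout_factor:
  assumes Y: "differential_bundle X Y" "base_ob X Y = E"
    and x: "linear_morphism X P Y (Id X E) x" and y: "linear_morphism X Z Y (Id X E) y"
    and eq: "\<iota> \<cdot> x = proj V \<cdot> y"
  shows "\<exists>!h. linear_morphism X F Y (Id X E) h \<and> \<pi> \<cdot> h = x \<and> zero F \<cdot> h = y"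
proof -
  let ?D = "DB X E"
  have xy: "(P, x, Y) \<in> hom ?D P Y" "(Z, y, Y) \<in> hom ?D Z Y"
    "Comp ?D (V, \<iota>, P) (P, x, Y) = Comp ?D (V, proj V, Z) (Z, y, Y)"
    using x y Y P Z eq by (simp_all add: hom_def DB_def)
  have cod: "Cod ?D (V, \<iota>, P) = P" "Cod ?D (V, proj V, Z) = Z" "Cod ?D (P, \<pi>, F) = F"
    by (simp_all add: DB_def)
  have U: "\<forall>Y x y. x \<in> hom ?D P Y \<and> y \<in> hom ?D Z Y
      \<and> Comp ?D (V, \<iota>, P) x = Comp ?D (V, proj V, Z) y \<longrightarrow>
      (\<exists>!h. h \<in> hom ?D F Y \<and> Comp ?D (P, \<pi>, F) h = x \<and> Comp ?D (Z, zero F, F) h = y)"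
    using pushout unfolding is_pushout_def cod by (elim conjE)
  have ex: "\<exists>!h. h \<in> hom ?D F Y \<and> Comp ?D (P, \<pi>, F) h = (P, x, Y)
      \<and> Comp ?D (Z, zero F, F) h = (Z, y, Y)"
    by (rule mp[OF spec[OF spec[OF spec[OF U]]]]) (use xy in simp)
  have iff: "(F, h, Y) \<in> hom ?D F Y \<and> Comp ?D (P, \<pi>, F) (F, h, Y) = (P, x, Y)
      \<and> Comp ?D (Z, zero F, F) (F, h, Y) = (Z, y, Y)
    \<longleftrightarrow> linear_morphism X F Y (Id X E) h \<and> \<pi> \<cdot> h = x \<and> zero F \<cdot> h = y" for h
    using F Y by (auto simp: hom_def DB_def)
  from ex obtain k where k: "k \<in> hom ?D F Y" "Comp ?D (P, \<pi>, F) k = (P, x, Y)"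
    "Comp ?D (Z, zero F, F) k = (Z, y, Y)"
    by blast
  then obtain h where h: "k = (F, h, Y)"
    by (auto simp: hom_def DB_def)
  show ?thesis
  proof (rule ex1I[of _ h])
    show "linear_morphism X F Y (Id X E) h \<and> \<pi> \<cdot> h = x \<and> zero F \<cdot> h = y"
      using k iff unfolding h by blast
    show "h' = h" if "linear_morphism X F Y (Id X E) h' \<and> \<pi> \<cdot> h' = x \<and> zero F \<cdot> h' = y" for h'
      using ex that k iff[of h'] unfolding h by blast
  qed
qed

text \<open>The trivial bundle is a zero object, so the pushout is a cokernel and \<open>\<pi>\<close> is epi among
  linear morphisms: their restrictions along the zero of \<open>F\<close> agree automatically.\<close>

lemma linear_from_F_eqI:
  assumes Y: "differential_bundle X Y" "base_ob X Y = E"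
    and h: "linear_morphism X F Y (Id X E) h" and k: "linear_morphism X F Y (Id X E) k"
    and eq: "\<pi> \<cdot> h = \<pi> \<cdot> k"
  shows "h = k"
proof -
  have zh: "zero F \<cdot> h = zero Y" and zk: "zero F \<cdot> k = zero Y"
    by (rule linear_preserves_zero[OF h F Y], rule linear_preserves_zero[OF k F Y])
  note H = linearD[OF h F] and K = linearD[OF k F]
  have "\<iota> \<cdot> (\<pi> \<cdot> k) = proj V \<cdot> (zero F \<cdot> k)"
    using comp_cong_left[OF square, of k] H K by simp
  from pushout_factor[OF Y linear_comp[OF square_linear(3) k P F Y]
      linear_comp[OF square_linear(4) k Z F Y] this]
  show ?thesis
    using h k eq zh zk by metis
qed

lemma zero_absorb:
  assumes "a \<in> Ar X" "Cod X a = TE"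
  shows "same_base X E (a \<cdot> (p \<cdot> z)) a" "same_base X E a (a \<cdot> (p \<cdot> z))"
    "tsum X E (a \<cdot> (p \<cdot> z)) a = a" "tsum X E a (a \<cdot> (p \<cdot> z)) = a"
proof -
  note b = bsum_zero_left[OF additive[of E], of a]
  show 1: "same_base X E (a \<cdot> (p \<cdot> z)) a" "tsum X E (a \<cdot> (p \<cdot> z)) a = a"
    using b assms by simp_all
  then show s: "same_base X E a (a \<cdot> (p \<cdot> z))"
    using same_fibre_sym by blast
  show "tsum X E a (a \<cdot> (p \<cdot> z)) = a"
    using bsum_commute[OF additive[of E] s] 1 by simp
qed

text \<open>The mixed condition \<open>H R = 0\<close> follows from the decomposition of the identity, by
  precomposing it with \<open>H\<close> and cancelling \<open>H \<pi> H = H\<close>.\<close>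

lemma ehresmann_connection_iff:
  "ehresmann_connection X q V \<iota> F tF R H \<longleftrightarrow>
     vertical_connection X q V \<iota> R \<and> horizontal_connection X q F tF H
     \<and> tsum X E (R \<cdot> \<iota>) (\<pi> \<cdot> H) = Id X TE"
proof -
  have "H \<cdot> R = proj F \<cdot> zero V"
    if v: "vertical_connection X q V \<iota> R" and h: "horizontal_connection X q F tF H"
      and id: "tsum X E (R \<cdot> \<iota>) (\<pi> \<cdot> H) = Id X TE"
  proof -
    have "linear_morphism X P V (Id X E) R"
      using v by (simp add: vertical_connection_def)
    note R = linearD[OF this P]
    have "linear_morphism X F P (Id X E) H" and H\<pi>: "H \<cdot> \<pi> = Id X (total_ob X F)"
      using h by (simp_all add: horizontal_connection_def)
    note H = linearD[OF this(1) F, simplified]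
    have sb: "same_base X E (R \<cdot> \<iota>) (\<pi> \<cdot> H)"
      using R(1-4) H(1-4) \<pi>_projF \<iota>_p by (simp add: same_base_iff)
    have H\<pi>H: "H \<cdot> (\<pi> \<cdot> H) = H"
      using comp_cong_left[OF H\<pi>] H(1-3) by simp
    have sb': "same_base X E (H \<cdot> (R \<cdot> \<iota>)) H"
      using same_fibre_comp[OF tangent_summable sb, of H] R(1-3) H(1-3) H\<pi>H by simp
    have "tsum X E (H \<cdot> (R \<cdot> \<iota>)) H = H \<cdot> tsum X E (R \<cdot> \<iota>) (\<pi> \<cdot> H)"
      using comp_bsum[OF tangent_summable sb, of H] R(1-3) H(1-3) H\<pi>H by simp
    also have "\<dots> = tsum X E (H \<cdot> (p \<cdot> z)) H"
      using zero_absorb(3)[OF H(1,3)] H(1-3) by (simp add: id)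
    finally have "H \<cdot> (R \<cdot> \<iota>) = H \<cdot> (p \<cdot> z)"
      by (rule tsum_right_cancel[OF E_M(1) sb' zero_absorb(1)[OF H(1,3)]])
    also have "\<dots> = proj F \<cdot> z"
      using comp_cong_left[OF H(4), of z] H(1-3) by simp
    also have "\<dots> = (proj F \<cdot> zero V) \<cdot> \<iota>"
      by (simp add: zeroV_\<iota>)
    finally have eq: "(H \<cdot> R) \<cdot> \<iota> = (proj F \<cdot> zero V) \<cdot> \<iota>"
      using R(1-3) H(1-3) by simp
    show ?thesis
      by (rule \<iota>_mono[OF _ _ _ _ _ eq]) (use R(1-3) H(1-3) in simp_all)
  qed
  then show ?thesis
    unfolding ehresmann_connection_def bsum_def by auto
qed

text \<open>Here \<open>\<phi> = id - R \<iota>\<close> factors through the cokernel \<open>\<pi>\<close> of \<open>\<iota>\<close>.\<close>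

theorem vertical_connection_unique_horizontal:
  assumes v: "vertical_connection X q V \<iota> R"
  shows "\<exists>!H. horizontal_connection X q F tF H \<and> ehresmann_connection X q V \<iota> F tF R H"
proof -
  have Rlin: "linear_morphism X P V (Id X E) R" and \<iota>R: "\<iota> \<cdot> R = Id X (total_ob X V)"
    using v by (simp_all add: vertical_connection_def)
  note R = linearD[OF Rlin P, simplified]
  let ?f = "R \<cdot> \<iota>"
  note f = linearD[OF linear_comp[OF Rlin square_linear(1) P V P] P, simplified]
  obtain \<phi> where \<phi>: "same_base X E \<phi> ?f" "\<phi> \<cdot> p = p" "\<phi> \<in> hom X TE TE"
    and id: "tsum X E \<phi> ?f = Id X TE"
    using complement_exists[of E ?f] f R by (auto simp: hom_def)
  have \<phi>': "\<phi> \<in> Ar X" "Dom X \<phi> = TE" "Cod X \<phi> = TE"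
    using \<phi>(3) by (auto simp: hom_def)
  have "\<phi> \<cdot> T_lift X E = T_lift X E \<cdot> T_ar X \<phi>"
    by (rule complement_linear[OF E_M(1) \<phi>(1) _ id]) (use f R in simp_all)
  then have \<phi>lin: "linear_morphism X P P (Id X E) \<phi>"
    using \<phi>(2) \<phi>' by (simp add: linear_morphism_def hom_def)

  \<comment> \<open>The zero vectors over the arrow \<open>\<iota> p\<close>: this is \<open>\<iota> \<phi> = \<iota> - \<iota> R \<iota> = 0\<close>.\<close>
  have "\<iota> \<cdot> \<phi> = \<iota> \<cdot> (p \<cdot> z)"
  proof (rule tsum_right_cancel[OF E_M(1) _ zero_absorb(1)])
    have \<iota>f: "\<iota> \<cdot> ?f = \<iota>"
      using comp_cong_left[OF \<iota>R] R(1-3) by simp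
    show "same_base X E (\<iota> \<cdot> \<phi>) \<iota>"
      using same_fibre_comp[OF tangent_summable \<phi>(1), of \<iota>] \<phi>' \<iota>f by simp
    have "tsum X E (\<iota> \<cdot> \<phi>) \<iota> = \<iota> \<cdot> tsum X E \<phi> ?f"
      using comp_bsum[OF tangent_summable \<phi>(1), of \<iota>] \<phi>' \<iota>f by simp
    also have "\<dots> = tsum X E (\<iota> \<cdot> (p \<cdot> z)) \<iota>"
      using zero_absorb(3)[of \<iota>] by (simp add: id)
    finally show "tsum X E (\<iota> \<cdot> \<phi>) \<iota> = tsum X E (\<iota> \<cdot> (p \<cdot> z)) \<iota>" .
  qed simp_all
  also have "\<dots> = proj V \<cdot> z"
    using comp_cong_left[OF \<iota>_p, of z] by simp
  finally have cocone: "\<iota> \<cdot> \<phi> = proj V \<cdot> z" .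
  have "z \<cdot> T_lift X E = z \<cdot> T_ar X z"
    using lift_additive[of E] by (simp add: additive_bundle_morphism_def)
  then have zlin: "linear_morphism X Z P (Id X E) z"
    using Z(2) by (simp add: linear_morphism_def hom_def)
  from pushout_factor[OF P \<phi>lin zlin cocone] obtain H
    where Hlin: "linear_morphism X F P (Id X E) H" and \<pi>H: "\<pi> \<cdot> H = \<phi>"
    by blast
  note H = linearD[OF Hlin F, simplified]

  have RtV: "R \<cdot> tV = p \<cdot> q"
  proof -
    have 1: "\<iota> \<cdot> T_ar X q = tV \<cdot> T_zero X M"
      using pullbackD(9)[OF V_pullback(1)] .
    have nat: "T_ar X q \<cdot> T_proj X M = p \<cdot> q"
      using proj_natural[of q E M] by (simp add: hom_def)
    have "tV = (tV \<cdot> T_zero X M) \<cdot> T_proj X M"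
      by simp
    also have "\<dots> = (\<iota> \<cdot> p) \<cdot> q"
      unfolding 1[symmetric] by (simp add: nat)
    finally have "tV = proj V \<cdot> q"
      unfolding \<iota>_p .
    then show ?thesis
      using comp_cong_left[OF R(4), of q] R(1-3) by simp
  qed
  \<comment> \<open>\<open>R \<iota>\<close> takes vertical values, so it does not contribute to the image of \<open>\<phi> + R \<iota> = id\<close> under
    \<open>T(q)\<close>.\<close>
  have \<phi>Tq: "\<phi> \<cdot> T_ar X q = T_ar X q"
  proof -
    have "?f \<cdot> T_ar X q = R \<cdot> (tV \<cdot> T_zero X M)"
      using pullbackD(9)[OF V_pullback(1)] R(1-3) by simp
    also have "\<dots> = (p \<cdot> q) \<cdot> T_zero X M"
      using comp_cong_left[OF RtV] R(1-3) by simp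
    also have "\<dots> = (\<phi> \<cdot> T_ar X q) \<cdot> (T_proj X M \<cdot> T_zero X M)"
    proof -
      have "(\<phi> \<cdot> T_ar X q) \<cdot> T_proj X M = (\<phi> \<cdot> p) \<cdot> q"
        using proj_natural[of q E M] \<phi>' by (simp add: hom_def)
      then have "(\<phi> \<cdot> T_ar X q) \<cdot> T_proj X M = p \<cdot> q"
        by (simp only: \<phi>(2))
      from comp_cong_left[OF this, of "T_zero X M"] show ?thesis
        using \<phi>' by simp
    qed
    finally have fTq: "?f \<cdot> T_ar X q = (\<phi> \<cdot> T_ar X q) \<cdot> (T_proj X M \<cdot> T_zero X M)" .
    note zl = bsum_zero_left[OF additive[of M], of "\<phi> \<cdot> T_ar X q"]
    have s: "same_base X M (\<phi> \<cdot> T_ar X q) (?f \<cdot> T_ar X q)"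
      using zl(2) \<phi>' fTq same_fibre_sym by simp
    have "T_ar X q = tsum X E \<phi> ?f \<cdot> T_ar X q"
      by (simp add: id)
    also have "\<dots> = tsum X M (\<phi> \<cdot> T_ar X q) (?f \<cdot> T_ar X q)"
      by (rule tsum_T(1)[OF q \<phi>(1)])
    also have "\<dots> = tsum X M (?f \<cdot> T_ar X q) (\<phi> \<cdot> T_ar X q)"
      by (rule bsum_commute[OF additive s]) simp
    also have "\<dots> = \<phi> \<cdot> T_ar X q"
      unfolding fTq using zl(1) \<phi>' by simp
    finally show ?thesis by simp
  qed
  have \<phi>\<pi>: "\<phi> \<cdot> \<pi> = \<pi>"
    by (rule pullback_ext[OF F_pullback])
      (use \<phi>' \<phi>(2) \<phi>Tq \<pi>_projF \<pi>_tF in simp_all)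
  have "H \<cdot> \<pi> = Id X (total_ob X F)"
  proof (rule linear_from_F_eqI[OF F linear_comp[OF Hlin square_linear(3) F P F]])
    show "linear_morphism X F F (Id X E) (Id X (total_ob X F))"
      using F(2) T_id[of "total_ob X F"] by (simp add: linear_morphism_def hom_def)
    show "\<pi> \<cdot> (H \<cdot> \<pi>) = \<pi> \<cdot> Id X (total_ob X F)"
      using comp_cong_left[OF \<pi>H, of \<pi>] H(1-3) \<phi>\<pi> by simp
  qed
  then have h: "horizontal_connection X q F tF H"
    using Hlin by (simp add: horizontal_connection_def)
  have id': "tsum X E ?f \<phi> = Id X TE"
    using bsum_commute[OF additive \<phi>(1)] by (simp add: id)
  show ?thesis
  proof (rule ex1I[of _ H])
    show "horizontal_connection X q F tF H \<and> ehresmann_connection X q V \<iota> F tF R H"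
      using v h id' by (simp add: ehresmann_connection_iff \<pi>H)
    fix H' assume a: "horizontal_connection X q F tF H' \<and> ehresmann_connection X q V \<iota> F tF R H'"
    then have H'lin: "linear_morphism X F P (Id X E) H'"
      and id'': "tsum X E ?f (\<pi> \<cdot> H') = Id X TE"
      by (simp_all add: horizontal_connection_def ehresmann_connection_iff)
    note H' = linearD[OF H'lin F, simplified]
    have s: "same_base X E (\<pi> \<cdot> H') ?f"
      using H'(1-4) R(1-4) \<pi>_projF \<iota>_p by (simp add: same_base_iff)
    have "tsum X E (\<pi> \<cdot> H') ?f = tsum X E \<phi> ?f"
      using bsum_commute[OF additive s] by (simp add: id id'')
    from tsum_right_cancel[OF E_M(1) s \<phi>(1) this]
    show "H' = H"
      by (rule linear_from_F_eqI[OF P H'lin Hlin, unfolded \<pi>H])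
  qed
qed

text \<open>Here \<open>\<psi> = id - \<pi> H\<close> factors through the kernel \<open>\<iota>\<close> of \<open>T(q)\<close>.\<close>

theorem horizontal_connection_unique_vertical:
  assumes h: "horizontal_connection X q F tF H"
  shows "\<exists>!R. vertical_connection X q V \<iota> R \<and> ehresmann_connection X q V \<iota> F tF R H"
proof -
  have Hlin: "linear_morphism X F P (Id X E) H" and H\<pi>: "H \<cdot> \<pi> = Id X (total_ob X F)"
    using h by (simp_all add: horizontal_connection_def)
  note H = linearD[OF Hlin F, simplified]
  let ?f = "\<pi> \<cdot> H"
  note f = linearD[OF linear_comp[OF square_linear(3) Hlin P F P] P, simplified]
  obtain \<psi> where \<psi>: "same_base X E \<psi> ?f" "\<psi> \<cdot> p = p" "\<psi> \<in> hom X TE TE"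
    and id: "tsum X E \<psi> ?f = Id X TE"
    using complement_exists[of E ?f] f H by (auto simp: hom_def)
  have \<psi>': "\<psi> \<in> Ar X" "Dom X \<psi> = TE" "Cod X \<psi> = TE"
    using \<psi>(3) by (auto simp: hom_def)
  have \<psi>lin: "\<psi> \<cdot> T_lift X E = T_lift X E \<cdot> T_ar X \<psi>"
    by (rule complement_linear[OF E_M(1) \<psi>(1) _ id]) (use f H in simp_all)

  have nat: "T_ar X q \<cdot> T_proj X M = p \<cdot> q"
    using proj_natural[of q E M] by (simp add: hom_def)
  \<comment> \<open>Cancel \<open>\<pi> H T(q) = T(q)\<close> from the image of \<open>\<psi> + \<pi> H = id\<close> under \<open>T(q)\<close>.\<close>
  have "\<psi> \<cdot> T_ar X q = T_ar X q \<cdot> (T_proj X M \<cdot> T_zero X M)"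
  proof (rule tsum_right_cancel[of M])
    have "H \<cdot> T_ar X q = (H \<cdot> \<pi>) \<cdot> tF"
      using H(1-3) by (simp add: \<pi>_tF)
    also have "\<dots> = tF"
      by (simp add: H\<pi>)
    finally have fTq: "?f \<cdot> T_ar X q = T_ar X q"
      using H(1-3) by (simp add: \<pi>_tF)
    note t = tsum_T[OF q \<psi>(1)]
    show "same_base X M (\<psi> \<cdot> T_ar X q) (T_ar X q)"
      using t(2) unfolding fTq .
    note zl = bsum_zero_left[OF additive[of M], of "T_ar X q"]
    show "same_base X M (T_ar X q \<cdot> (T_proj X M \<cdot> T_zero X M)) (T_ar X q)"
      using zl(2) by simp
    show "tsum X M (\<psi> \<cdot> T_ar X q) (T_ar X q)
        = tsum X M (T_ar X q \<cdot> (T_proj X M \<cdot> T_zero X M)) (T_ar X q)"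
      using t(1) zl(1) unfolding fTq id by simp
  qed simp
  also have "\<dots> = (p \<cdot> q) \<cdot> T_zero X M"
    by (rule comp_cong_left[OF nat]) simp_all
  finally have sq: "\<psi> \<cdot> T_ar X q = (p \<cdot> q) \<cdot> T_zero X M" .
  define R where "R = pairing X \<iota> tV \<psi> (p \<cdot> q)"
  have R: "R \<in> Ar X" "Dom X R = TE" "Cod X R = total_ob X V" "R \<cdot> \<iota> = \<psi>"
    unfolding R_def using pairing[OF V_pullback(1), of \<psi> "p \<cdot> q"] \<psi>' sq by simp_all
  have "R \<cdot> proj V = p"
    unfolding \<iota>_p[symmetric] using comp_cong_left[OF R(4), of p] R(1-3) \<psi>(2) by simp
  moreover have "R \<cdot> lift V = T_lift X E \<cdot> T_ar X R"
  proof (rule T\<iota>_mono)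
    have "(R \<cdot> lift V) \<cdot> T_ar X \<iota> = R \<cdot> (\<iota> \<cdot> T_lift X E)"
      using R(1-3) by (simp add: \<iota>_lift)
    also have "\<dots> = T_lift X E \<cdot> T_ar X \<psi>"
      using comp_cong_left[OF R(4)] R(1-3) \<psi>lin by simp
    also have "\<dots> = (T_lift X E \<cdot> T_ar X R) \<cdot> T_ar X \<iota>"
      using R(1-3) unfolding R(4)[symmetric] by simp
    finally show "(R \<cdot> lift V) \<cdot> T_ar X \<iota> = (T_lift X E \<cdot> T_ar X R) \<cdot> T_ar X \<iota>" .
  qed (use R(1-3) in simp_all)
  ultimately have Rlin: "linear_morphism X P V (Id X E) R"
    using R(1-3) V(2) by (simp add: linear_morphism_def hom_def)
  have "\<iota> \<cdot> R = Id X (total_ob X V)"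
  proof (rule \<iota>_mono)
    have "zero F \<cdot> H = z"
      using linear_preserves_zero[OF Hlin F P] by simp
    then have "\<iota> \<cdot> ?f = proj V \<cdot> z"
      using comp_cong_left[OF square, of H] H(1-3) by simp
    also have "\<dots> = \<iota> \<cdot> (p \<cdot> z)"
      using comp_cong_left[OF \<iota>_p, of z] by simp
    finally have \<iota>f: "\<iota> \<cdot> ?f = \<iota> \<cdot> (p \<cdot> z)" .
    have s: "same_base X E (\<iota> \<cdot> \<psi>) (\<iota> \<cdot> (p \<cdot> z))"
      using same_fibre_comp[OF tangent_summable \<psi>(1), of \<iota>] \<psi>' \<iota>f by simp
    have "tsum X E (\<iota> \<cdot> \<psi>) (\<iota> \<cdot> (p \<cdot> z)) = \<iota> \<cdot> tsum X E \<psi> ?f"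
      using comp_bsum[OF tangent_summable \<psi>(1), of \<iota>] \<psi>' \<iota>f by simp
    also have "\<dots> = tsum X E \<iota> (\<iota> \<cdot> (p \<cdot> z))"
      using zero_absorb(4)[of \<iota>] by (simp add: id)
    finally have "\<iota> \<cdot> \<psi> = \<iota>"
      by (intro tsum_right_cancel[OF E_M(1) s zero_absorb(2)]) simp_all
    then show "(\<iota> \<cdot> R) \<cdot> \<iota> = Id X (total_ob X V) \<cdot> \<iota>"
      using R by simp
  qed (use R(1-3) in simp_all)
  then have v: "vertical_connection X q V \<iota> R"
    using Rlin by (simp add: vertical_connection_def)
  show ?thesis
  proof (rule ex1I[of _ R])
    show "vertical_connection X q V \<iota> R \<and> ehresmann_connection X q V \<iota> F tF R H"
      using v h id by (simp add: ehresmann_connection_iff R(4))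
    fix R' assume a: "vertical_connection X q V \<iota> R' \<and> ehresmann_connection X q V \<iota> F tF R' H"
    then have R'lin: "linear_morphism X P V (Id X E) R'"
      and id': "tsum X E (R' \<cdot> \<iota>) ?f = Id X TE"
      by (simp_all add: vertical_connection_def ehresmann_connection_iff)
    note R' = linearD[OF R'lin P, simplified]
    have "same_base X E (R' \<cdot> \<iota>) ?f"
      using H(1-4) R'(1-4) \<pi>_projF \<iota>_p by (simp add: same_base_iff)
    from tsum_right_cancel[OF E_M(1) this \<psi>(1)] have "R' \<cdot> \<iota> = R \<cdot> \<iota>"
      by (simp add: id id' R(4))
    from \<iota>_mono[OF _ _ _ _ _ this] show "R' = R"
      using R R'(1-3) by simp
  qed
qed

end


theorem theorem3p25:
  fixes X :: "('o, 'm) tangent_category"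
    and V F :: "'m lifted_bundle"
    and q \<iota> tV tF :: 'm
  assumes "tangent_category X"
    and "has_negatives X"
    and "submersion X q V \<iota> tV F tF"
  shows "(\<forall>R. vertical_connection X q V \<iota> R \<longrightarrow>
            (\<exists>!H. horizontal_connection X q F tF H \<and> ehresmann_connection X q V \<iota> F tF R H))
       \<and> (\<forall>H. horizontal_connection X q F tF H \<longrightarrow>
            (\<exists>!R. vertical_connection X q V \<iota> R \<and> ehresmann_connection X q V \<iota> F tF R H))"
proof -
  interpret submersion_with_negatives X q V \<iota> tV F tF
    using assms by (simp add: submersion_with_negatives_def submersion_with_negatives_axioms_def
        tangent_category_with_negatives_def tangent_category_with_negatives_axioms_def)
  show ?thesis
    using vertical_connection_unique_horizontal horizontal_connection_unique_vertical by blast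
qed

end
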